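(* Let $\phi(r)$ be a positive non-decreasing function defined on $[1,\infty)$ with $\lim_{r\to\infty}\phi(r) = \infty$. Then there exists a function $f$ transcendental and meromorphic in the plane with $$\limsup_{r\to\infty} \frac{T(r,f)}{r} < \infty \quad\text{and}\quad \liminf_{r\to\infty}\frac{T(r,f)}{\phi(r)\log r} < \infty,$$ such that $g(z) = \Delta f(z) = f(z+1) - f(z)$ has exactly one zero. Moreover, $g$ satisfies $$\limsup_{r\to\infty}\frac{T(r,g)}{\phi(r)\log r} < \infty.$$
   Context: $T(r,f)$ denotes the Nevanlinna characteristic of a meromorphic function $f$. *)

theory Defs
  imports "HOL-Complex_Analysis.Complex_Analysis" "HOL-Computational_Algebra.Polynomial"
begin

definition log_plus :: "real \<Rightarrow> real" where
  "log_plus x = max 0 (ln x)"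

definition nev_m :: "real \<Rightarrow> (complex \<Rightarrow> complex) \<Rightarrow> real" where
  "nev_m r f = integral {0..2*pi} (\<lambda>t. log_plus (cmod (f (complex_of_real r * cis t)))) / (2*pi)"

definition nev_n :: "real \<Rightarrow> (complex \<Rightarrow> complex) \<Rightarrow> real" where
  "nev_n t f = (\<Sum>z\<in>{z. z \<in> cball 0 t \<and> is_pole f z}. real (nat (- zorder f z)))"

definition nev_N :: "real \<Rightarrow> (complex \<Rightarrow> complex) \<Rightarrow> real" where
  "nev_N r f = integral {0..r} (\<lambda>t. (nev_n t f - nev_n 0 f) / t) + nev_n 0 f * ln r"

definition nev_T :: "real \<Rightarrow> (complex \<Rightarrow> complex) \<Rightarrow> real" where
  "nev_T r f = nev_m r f + nev_N r f"

definition rational_fun :: "(complex \<Rightarrow> complex) \<Rightarrow> bool" where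
  "rational_fun f \<longleftrightarrow> (\<exists>p q :: complex poly. q \<noteq> 0 \<and>
      (\<forall>z. \<forall>\<^sub>F w in at z. f w = poly p w / poly q w))"

text \<open>Zeros of a meromorphic function (value-independent: limit at the point is 0).\<close>
definition mero_zeros :: "(complex \<Rightarrow> complex) \<Rightarrow> complex set" where
  "mero_zeros g = {z. (g \<longlongrightarrow> 0) (at z)}"

end

theory Submission
  imports Defs
begin

text \<open>Take \<open>g(z) = z / \<Prod>\<^sub>j (1 + z^4 / (4 x\<^sub>j^4))\<close> for a very sparse sequence \<open>x\<^sub>j\<close> of natural numbers; its only
  zero is the simple one at 0. Expanding in partial fractions with respect to \<open>z^4\<close> gives
  \<open>g(z) = \<Sum>\<^sub>j a\<^sub>j z / (1 + z^4 / (4 x\<^sub>j^4))\<close>, and with \<open>b\<^sub>j(z) = 1 / (z^2 + x\<^sub>j^2)\<close> one has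
  \<open>z / (1 + z^4 / (4 x\<^sub>j^4)) = x\<^sub>j^3 (b\<^sub>j(z - x\<^sub>j) - b\<^sub>j(z + x\<^sub>j))\<close>. Since \<open>2 x\<^sub>j\<close> is a natural number, each summand
  is the difference of a finite sum of translates of \<open>b\<^sub>j\<close>, and these sums add up to \<open>f\<close>.

  Both functions are sums \<open>\<Sum> w / (z - p)\<close> with \<open>\<Sum> |w|^(1/2)\<close> finite. As \<open>log\<^sup>+ y \<le> 2 y^(1/2)\<close>, the square root
  is subadditive, and the means of \<open>|z - p|^(-1/2)\<close> over circles are bounded, the proximity functions are
  bounded. So the growth is decided by counting poles: \<open>g\<close> has four and \<open>f\<close> has \<open>4 x\<^sub>j\<close> of modulus comparable
  to \<open>x\<^sub>j\<close>. If \<open>x\<^sub>j\<^sub>+\<^sub>1\<close> is so large that \<open>\<phi>\<close> exceeds \<open>x\<^sub>j\<close> from \<open>x\<^sub>j\<^sub>+\<^sub>1 - 1\<close> on, then the radii \<open>x\<^sub>j\<^sub>+\<^sub>1 - 1\<close>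
  witness the lower limit for \<open>f\<close>.\<close>

section \<open>Upper bounds for Nevanlinna functions\<close>

lemma log_plus_le_sqrt:
  assumes "x \<ge> 0" shows "log_plus x \<le> 2 * sqrt x"
proof (cases "x = 0")
  case False
  with assms have "ln x = 2 * ln (sqrt x)" by (simp add: ln_sqrt)
  also have "\<dots> \<le> 2 * sqrt x" using assms False by (simp add: ln_bound)
  finally show ?thesis using assms by (simp add: log_plus_def)
qed (simp add: log_plus_def)

lemma sqrt_sum_le_sum_sqrt:
  assumes "\<And>i. i \<in> I \<Longrightarrow> f i \<ge> (0::real)"
  shows "sqrt (\<Sum>i\<in>I. f i) \<le> (\<Sum>i\<in>I. sqrt (f i))"
  using assms
proof (induction I rule: infinite_finite_induct)
  case (insert i I)
  have "sqrt (f i + sum f I) \<le> sqrt (f i) + sqrt (sum f I)"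
    using insert by (intro sqrt_add_le_add_sqrt) (auto intro: sum_nonneg)
  also have "\<dots> \<le> sqrt (f i) + (\<Sum>i\<in>I. sqrt (f i))" using insert by auto
  finally show ?case using insert by simp
qed auto

text \<open>\<^const>\<open>sqrt\<close> is an odd function, so \<open>2 * sqrt (t - c)\<close> is an antiderivative on both sides of \<open>c\<close>.\<close>
lemma has_integral_inverse_sqrt_abs:
  fixes a b c :: real
  assumes "a \<le> b"
  shows "((\<lambda>t. 1 / sqrt \<bar>t - c\<bar>) has_integral 2 * sqrt (b - c) - 2 * sqrt (a - c)) {a..b}"
proof (rule fundamental_theorem_of_calculus_interior_strong[of "{c}" a b "\<lambda>t. 2 * sqrt (t - c)"])
  fix t assume "t \<in> {a<..<b} - {c}"
  then have "t - c \<noteq> 0" by auto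
  then have "(sqrt has_real_derivative 1 / sqrt \<bar>t - c\<bar> / 2) (at (t - c))"
    by (intro DERIV_real_sqrt_generic)
      \<comment> \<open>\<open>DERIV_real_sqrt_generic\<close> treats the two signs separately; for
        a negative argument the derivative of the odd root is again positive, which the absolute
        value records.\<close>
      (auto simp: divide_simps abs_if real_sqrt_minus[symmetric] simp del: real_sqrt_minus minus_diff_eq)
  then have "((\<lambda>t. sqrt (t - c)) has_real_derivative 1 / sqrt \<bar>t - c\<bar> / 2 * 1) (at t)"
    by (rule DERIV_chain2) (auto intro!: derivative_eq_intros)
  from DERIV_cmult[OF this, of 2] 
  show "((\<lambda>t. 2 * sqrt (t - c)) has_vector_derivative 1 / sqrt \<bar>t - c\<bar>) (at t)"
    by (simp add: has_real_derivative_iff_has_vector_derivative)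
qed (use assms in \<open>auto intro!: continuous_intros\<close>)

section \<open>Means of \<open>|z - p|^(-1/2)\<close> over circles\<close>

lemma half_le_sin:
  fixes u :: real
  assumes "0 \<le> u" "u \<le> pi / 2" shows "u / 2 \<le> sin u"
proof -
  have "\<bar>sin u - (\<Sum>m<3. sin_coeff m * u ^ m)\<bar> \<le> inverse (fact 3) * \<bar>u\<bar> ^ 3"
    by (rule Maclaurin_sin_bound)
  then have "u - u ^ 3 / 6 \<le> sin u"
    using assms by (simp add: sin_coeff_def numeral_eq_Suc lessThan_Suc field_simps abs_if split: if_splits)
  \<comment> \<open>Since \<open>pi / 2 < 1.6\<close> and \<open>1.6 * 1.6 < 3\<close>, the cubic
    term \<open>u ^ 3 / 6\<close> is at most \<open>u / 2\<close>.\<close>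
  moreover have "u * u \<le> 1.6 * 1.6" using assms pi_approx by (intro mult_mono) auto
  then have "u * (u * u) \<le> u * 3" using assms by (intro mult_left_mono) auto
  ultimately show ?thesis by (simp add: power3_eq_cube mult.assoc)
qed

lemma min_le_abs_sin:
  fixes u :: real
  assumes "\<bar>u\<bar> \<le> pi" shows "min \<bar>u\<bar> (pi - \<bar>u\<bar>) / 2 \<le> \<bar>sin u\<bar>"
proof -
  have "sin \<bar>u\<bar> \<ge> 0" using assms by (intro sin_ge_zero) auto
  then have "\<bar>sin u\<bar> = sin \<bar>u\<bar>" by (cases "u \<ge> 0") auto
  moreover have "min \<bar>u\<bar> (pi - \<bar>u\<bar>) / 2 \<le> sin \<bar>u\<bar>"
  proof (cases "\<bar>u\<bar> \<le> pi / 2")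
    case True
    then show ?thesis using half_le_sin[of "\<bar>u\<bar>"] by auto
  next
    case False
    then show ?thesis using half_le_sin[of "pi - \<bar>u\<bar>"] assms by (auto simp: min_def)
  qed
  ultimately show ?thesis by simp
qed

text \<open>By the law of cosines the squared distance is
  \<open>(r - \<rho>)^2 + 4 r \<rho> sin^2 ((t - \<alpha>) / 2)\<close>. Dropping the first square
  and using \<open>r \<rho> \<ge> 1\<close> leaves a bound in the angles alone, uniform in both
  radii.\<close>

lemma norm_circle_diff_ge:
  assumes "r \<ge> 1" "\<rho> \<ge> 1"
  shows "cmod (of_real r * cis t - of_real \<rho> * cis \<alpha>) \<ge> 2 * \<bar>sin ((t - \<alpha>) / 2)\<bar>"
proof -
  have "(cmod (of_real r * cis t - of_real \<rho> * cis \<alpha>))\<^sup>2 =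
      (r * cos t - \<rho> * cos \<alpha>)\<^sup>2 + (r * sin t - \<rho> * sin \<alpha>)\<^sup>2"
    by (simp add: cmod_power2)
  also have "\<dots> = r\<^sup>2 * ((cos t)\<^sup>2 + (sin t)\<^sup>2) + \<rho>\<^sup>2 * ((cos \<alpha>)\<^sup>2 + (sin \<alpha>)\<^sup>2)
      - 2 * r * \<rho> * (cos t * cos \<alpha> + sin t * sin \<alpha>)"
    unfolding power2_eq_square by algebra
  also have "\<dots> = r\<^sup>2 + \<rho>\<^sup>2 - 2 * r * \<rho> * cos (t - \<alpha>)"
    by (simp add: cos_diff)
  also have "\<dots> = (r - \<rho>)\<^sup>2 + 2 * (r * \<rho>) * (1 - cos (t - \<alpha>))"
    by (simp add: power2_eq_square algebra_simps)
  also have "1 - cos (t - \<alpha>) = 2 * (sin ((t - \<alpha>) / 2))\<^sup>2"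
    using cos_double_sin[of "(t - \<alpha>) / 2"] by (simp only: mult_2 field_sum_of_halves)
  finally have eq: "(cmod (of_real r * cis t - of_real \<rho> * cis \<alpha>))\<^sup>2 =
    (r - \<rho>)\<^sup>2 + 4 * (r * \<rho>) * (sin ((t - \<alpha>) / 2))\<^sup>2" by simp
  have "1 * 1 \<le> r * \<rho>" using assms by (intro mult_mono) auto
  then have "4 * 1 * (sin ((t - \<alpha>) / 2))\<^sup>2 \<le> 4 * (r * \<rho>) * (sin ((t - \<alpha>) / 2))\<^sup>2"
    by (intro mult_right_mono) auto
  then have "(2 * \<bar>sin ((t - \<alpha>) / 2)\<bar>)\<^sup>2 \<le> (cmod (of_real r * cis t - of_real \<rho> * cis \<alpha>))\<^sup>2"
    unfolding eq by (simp add: power2_eq_square add_increasing)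
  then show ?thesis by (rule power2_le_imp_le) simp
qed

text \<open>An integrable majorant \<open>G\<close> is produced instead of a bound on the integral
  of the kernel, so integrability of the kernel itself never has to be shown. The constant depends
  on neither \<open>r\<close> nor \<open>p\<close>.\<close>

lemma circle_kernel_bound:
  assumes "r \<ge> 1" "cmod p \<ge> 1"
  obtains G I where "(G has_integral I) {0..2*pi}" "I \<le> 100"
    "\<And>t. t \<in> {0..2*pi} \<Longrightarrow> 1 / sqrt (cmod (of_real r * cis t - p)) \<le> G t"
proof -
  define \<alpha> where "\<alpha> = Arg2pi p"
  have \<alpha>: "0 \<le> \<alpha>" "\<alpha> < 2 * pi" by (auto simp: \<alpha>_def Arg2pi_ge_0 Arg2pi_lt_2pi)
  have p: "p = of_real (cmod p) * cis \<alpha>"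
    by (metis \<alpha>_def Arg2pi_eq cis_conv_exp mult.commute)
  \<comment> \<open>These are the arguments of \<open>p\<close> that can be nearest to some
    \<open>t\<close> in \<open>{0..2*pi}\<close>; \<open>G0\<close> has one singularity at
    each.\<close>
  define C where "C = {\<alpha>, \<alpha> + 2*pi, \<alpha> - 2*pi}"
  define h where "h = (\<lambda>t. 1 / sqrt (cmod (of_real r * cis t - p)))"
  define G0 where "G0 = (\<lambda>t. sqrt 2 * (1 / sqrt \<bar>t - \<alpha>\<bar> + (1 / sqrt \<bar>t - (\<alpha> + 2*pi)\<bar> + 1 / sqrt \<bar>t - (\<alpha> - 2*pi)\<bar>)))"
  define V where "V = (\<lambda>c. 2 * sqrt (2*pi - c) - 2 * sqrt (0 - c))"
  define I where "I = sqrt 2 * (V \<alpha> + (V (\<alpha> + 2*pi) + V (\<alpha> - 2*pi)))"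
  have G0: "(G0 has_integral I) {0..2*pi}"
    unfolding G0_def I_def V_def
    by (intro has_integral_mult_right has_integral_add has_integral_inverse_sqrt_abs) auto
  \<comment> \<open>For the odd root, \<open>- sqrt (0 - c)\<close> equals \<open>sqrt c\<close>.
    Both roots have arguments at most \<open>4 * pi < 16\<close>, so each is at most 4. Three such
    values and the factor \<open>sqrt 2 \<le> 2\<close> give 96.\<close>
  have V: "V c \<le> 16" if "-2*pi \<le> c" "c \<le> 4 * pi" for c
  proof -
    have "sqrt (2*pi - c) \<le> sqrt (4\<^sup>2)" using that pi_less_4 by (intro real_sqrt_le_mono) auto
    moreover have "sqrt c \<le> sqrt (4\<^sup>2)" using that pi_less_4 by (intro real_sqrt_le_mono) auto
    ultimately show ?thesis unfolding V_def by (simp add: real_sqrt_minus)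
  qed
  have "V \<alpha> + (V (\<alpha> + 2*pi) + V (\<alpha> - 2*pi)) \<le> 16 + (16 + 16)"
    using \<alpha> by (intro add_mono V) auto
  then have "I \<le> sqrt 2 * 48" unfolding I_def by (intro mult_left_mono) auto
  also have "sqrt 2 \<le> 2" by (simp add: real_le_lsqrt)
  finally have I: "I \<le> 100" by simp
  \<comment> \<open>At the points of \<open>C\<close> a summand of \<open>G0\<close> is \<open>1 / 0 = 0\<close>, so \<open>G0\<close> need not dominate \<open>h\<close> there.\<close>
  define G where "G = (\<lambda>t. if t \<in> C then h t else G0 t)"
  have "(G has_integral I) {0..2*pi}"
    by (rule has_integral_spike_finite[OF _ _ G0, of C]) (auto simp: C_def G_def)
  moreover have "h t \<le> G t" if t: "t \<in> {0..2*pi}" for t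
  proof (cases "t \<in> C")
    case False
    define s where "s = t - \<alpha>"
    have s: "\<bar>s / 2\<bar> \<le> pi" using t \<alpha> by (auto simp: s_def)
    have "2 * \<bar>sin (s / 2)\<bar> \<le> cmod (of_real r * cis t - p)"
      using norm_circle_diff_ge[of r "cmod p" t \<alpha>] assms p by (simp add: s_def)
    with min_le_abs_sin[OF s] 
    have *: "min \<bar>s\<bar> (2 * pi - \<bar>s\<bar>) / 2 \<le> cmod (of_real r * cis t - p)" by (auto simp: min_def split: if_splits)
    have "\<exists>c\<in>C. min \<bar>s\<bar> (2 * pi - \<bar>s\<bar>) = \<bar>t - c\<bar>"
      using t \<alpha> by (auto simp: C_def s_def min_def abs_if)
    then obtain c where c: "c \<in> C" "\<bar>t - c\<bar> / 2 \<le> cmod (of_real r * cis t - p)"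
      using * by metis
    have "\<bar>t - c\<bar> > 0" using c False by auto
    then have "h t \<le> 1 / sqrt (\<bar>t - c\<bar> / 2)"
      unfolding h_def using c by (intro divide_left_mono) (auto intro!: mult_pos_pos simp: real_sqrt_le_mono)
    also have "\<dots> = sqrt 2 * (1 / sqrt \<bar>t - c\<bar>)" by (simp add: real_sqrt_divide)
    also have "\<dots> \<le> G0 t"
      unfolding G0_def using c by (intro mult_left_mono) (auto simp: C_def)
    finally show ?thesis using False by (simp add: G_def)
  qed (simp add: G_def)
  ultimately show ?thesis using I that h_def by blast
qed

text \<open>\<open>log_plus\<close> is replaced by a square root, which is subadditive, so each pole
  contributes its own circle mean. The constant \<open>D\<close> leaves room for the bounded tail of
  an infinite series.\<close>

lemma nev_m_le_pole_sum:
  fixes w P :: "'i \<Rightarrow> complex"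
  assumes r: "r \<ge> 1" and I: "finite I" and P: "\<And>i. i \<in> I \<Longrightarrow> cmod (P i) \<ge> 1" and D: "D \<ge> 0"
    and h: "\<And>z. cmod z = r \<Longrightarrow> cmod (h z) \<le> (\<Sum>i\<in>I. cmod (w i) / cmod (z - P i)) + D"
  shows "nev_m r h \<le> 100 * (\<Sum>i\<in>I. sqrt (cmod (w i))) + 2 * sqrt D"
proof -
  have "\<forall>i\<in>I. \<exists>G J. (G has_integral J) {0..2*pi} \<and> J \<le> 100 \<and>
      (\<forall>t\<in>{0..2*pi}. 1 / sqrt (cmod (of_real r * cis t - P i)) \<le> G t)"
    using circle_kernel_bound[OF r P] by metis
  then obtain G J where G: "\<And>i. i \<in> I \<Longrightarrow> (G i has_integral J i) {0..2*pi}"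
    and J: "\<And>i. i \<in> I \<Longrightarrow> J i \<le> 100"
    and Gt: "\<And>i t. i \<in> I \<Longrightarrow> t \<in> {0..2*pi} \<Longrightarrow> 1 / sqrt (cmod (of_real r * cis t - P i)) \<le> G i t"
    by metis
  define S where "S = (\<Sum>i\<in>I. sqrt (cmod (w i)))"
  define B where "B = (\<lambda>t::real. 2 * ((\<Sum>i\<in>I. sqrt (cmod (w i)) * G i t) + sqrt D))"
  have B: "(B has_integral 2 * ((\<Sum>i\<in>I. sqrt (cmod (w i)) * J i) + 2 * pi * sqrt D)) {0..2*pi}"
    unfolding B_def using has_integral_const_real[of "sqrt D" 0 "2*pi"]
    by (intro has_integral_mult_right has_integral_add has_integral_sum G I) auto
  have S0: "S \<ge> 0" unfolding S_def by (intro sum_nonneg) auto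
  have le: "2 * ((\<Sum>i\<in>I. sqrt (cmod (w i)) * J i) + 2 * pi * sqrt D) \<le> 2 * (S * 100 + 2 * pi * sqrt D)"
    unfolding S_def sum_distrib_right by (intro mult_left_mono add_mono sum_mono J) auto
  have pt: "log_plus (cmod (h (of_real r * cis t))) \<le> B t" if t: "t \<in> {0..2*pi}" for t
  proof -
    let ?z = "of_real r * cis t"
    have "log_plus (cmod (h ?z)) \<le> 2 * sqrt (cmod (h ?z))" by (rule log_plus_le_sqrt) simp
    also have "sqrt (cmod (h ?z)) \<le> sqrt ((\<Sum>i\<in>I. cmod (w i) / cmod (?z - P i)) + D)"
      using r by (intro real_sqrt_le_mono h) (simp add: norm_mult)
    also have "\<dots> \<le> sqrt (\<Sum>i\<in>I. cmod (w i) / cmod (?z - P i)) + sqrt D"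
      using D by (intro sqrt_add_le_add_sqrt sum_nonneg) auto
    also have "sqrt (\<Sum>i\<in>I. cmod (w i) / cmod (?z - P i)) \<le> (\<Sum>i\<in>I. sqrt (cmod (w i) / cmod (?z - P i)))"
      by (rule sqrt_sum_le_sum_sqrt) auto
    also have "\<dots> = (\<Sum>i\<in>I. sqrt (cmod (w i)) * (1 / sqrt (cmod (?z - P i))))"
      by (simp add: real_sqrt_divide)
    also have "\<dots> \<le> (\<Sum>i\<in>I. sqrt (cmod (w i)) * G i t)"
      using Gt t by (intro sum_mono mult_left_mono) auto
    finally show ?thesis by (simp add: B_def)
  qed
  have "integral {0..2*pi} (\<lambda>t. log_plus (cmod (h (of_real r * cis t)))) \<le> 2 * (S * 100 + 2 * pi * sqrt D)"
  \<comment> \<open>A non-integrable integrand has \<open>integral\<close> equal to 0, and the bound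
    is nonnegative, so that case is harmless.\<close>
  proof (cases "(\<lambda>t. log_plus (cmod (h (of_real r * cis t)))) integrable_on {0..2*pi}")
    case True
    then show ?thesis using has_integral_le[OF integrable_integral[OF True] B pt] le by linarith
  next
    case False
    then show ?thesis using S0 D by (simp add: not_integrable_integral)
  qed
  then have "nev_m r h \<le> 2 * (S * 100 + 2 * pi * sqrt D) / (2 * pi)"
    unfolding nev_m_def by (intro divide_right_mono) auto
  also have "\<dots> = S * 100 / pi + 2 * sqrt D" by (simp add: field_simps)
  also have "S * 100 / pi \<le> S * 100 / 1" using pi_gt3 S0 by (intro divide_left_mono) auto
  finally show ?thesis by (simp add: S_def mult.commute)
qed

section \<open>Integrated counting functions\<close>

lemma nev_N_le_linear:
  assumes r: "r \<ge> 0" and "K \<ge> 0" and "nev_n 0 h = 0" and n: "\<And>t. 0 < t \<Longrightarrow> t \<le> r \<Longrightarrow> nev_n t h \<le> K * t"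
  shows "nev_N r h \<le> K * r"
proof -
  have B: "((\<lambda>t. K) has_integral r * K) {0..r}" using has_integral_const_real[of K 0 r] r by simp
  \<comment> \<open>At \<open>t = 0\<close> division by zero yields 0, which is below
    \<open>K\<close>.\<close>
  have le: "(nev_n t h - nev_n 0 h) / t \<le> K" if "t \<in> {0..r}" for t
    using that n[of t] assms by (cases "t = 0") (auto simp: divide_le_eq)
  have "integral {0..r} (\<lambda>t. (nev_n t h - nev_n 0 h) / t) \<le> K * r"
  proof (cases "(\<lambda>t. (nev_n t h - nev_n 0 h) / t) integrable_on {0..r}")
    case True
    then show ?thesis using has_integral_le[OF integrable_integral[OF True] B le] by (simp add: mult.commute)
  next
    case False
    then show ?thesis using r assms by (simp add: not_integrable_integral)
  qed
  then show ?thesis using assms by (simp add: nev_N_def)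
qed

text \<open>The counting function vanishes below radius 1, so the integrand is at most
  \<open>K / t\<close> on \<open>{1..r}\<close> and 0 before.\<close>

lemma nev_N_le_log:
  assumes r: "r \<ge> 1" and K: "K \<ge> 0" and n0: "\<And>t. t < 1 \<Longrightarrow> nev_n t h = 0"
    and n: "\<And>t. 1 \<le> t \<Longrightarrow> t \<le> r \<Longrightarrow> nev_n t h \<le> K"
  shows "nev_N r h \<le> K * ln r"
proof -
  have B1: "((\<lambda>t. K * (1 / t)) has_integral K * (ln r - ln 1)) {1..r}"
    using r by (intro has_integral_mult_right fundamental_theorem_of_calculus)
      (auto intro!: derivative_eq_intros simp: has_real_derivative_iff_has_vector_derivative[symmetric])
  define b where "b = (\<lambda>t::real. if t \<in> {1..r} then K * (1 / t) else 0)"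
  have B: "(b has_integral K * ln r) {0..r}"
    unfolding b_def using has_integral_restrict[of "{1..r}" "{0..r}" "\<lambda>t. K * (1 / t)"] B1 by auto
  have le: "(nev_n t h - nev_n 0 h) / t \<le> b t" if "t \<in> {0..r}" for t
    using that n[of t] n0[of t] n0[of 0] by (auto simp: b_def field_simps)
  have "integral {0..r} (\<lambda>t. (nev_n t h - nev_n 0 h) / t) \<le> K * ln r"
  proof (cases "(\<lambda>t. (nev_n t h - nev_n 0 h) / t) integrable_on {0..r}")
    case True
    then show ?thesis using has_integral_le[OF integrable_integral[OF True] B le] by simp
  next
    case False
    then show ?thesis using r K by (simp add: not_integrable_integral)
  qed
  then show ?thesis using n0[of 0] by (simp add: nev_N_def)
qed

section \<open>Series of simple poles\<close>

text \<open>The residue \<open>u\<close> may be 0, so points of analyticity are included and the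
  property is closed under addition. It yields meromorphy and, at a genuine pole, the order.\<close>

definition simple_pole_part :: "(complex \<Rightarrow> complex) \<Rightarrow> complex \<Rightarrow> bool" where
  "simple_pole_part f p \<longleftrightarrow>
    (\<exists>u H. H analytic_on {p} \<and> (\<forall>\<^sub>F z in at p. f z = u / (z - p) + H z))"

lemma simple_pole_part_analytic: "f analytic_on {p} \<Longrightarrow> simple_pole_part f p"
  unfolding simple_pole_part_def by (intro exI[of _ 0] exI[of _ f]) auto

lemma simple_pole_part_add:
  assumes "simple_pole_part f p" "simple_pole_part g p"
  shows "simple_pole_part (\<lambda>z. f z + g z) p"
proof -
  obtain u H v K where "H analytic_on {p}" "K analytic_on {p}"
    and f: "\<forall>\<^sub>F z in at p. f z = u / (z - p) + H z" and g: "\<forall>\<^sub>F z in at p. g z = v / (z - p) + K z"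
    using assms unfolding simple_pole_part_def by blast
  then have "(\<lambda>z. H z + K z) analytic_on {p}" by (intro analytic_intros)
  moreover have "\<forall>\<^sub>F z in at p. f z + g z = (u + v) / (z - p) + (H z + K z)"
    using f g by eventually_elim (simp add: add_divide_distrib)
  ultimately show ?thesis unfolding simple_pole_part_def by blast
qed

lemma simple_pole_part_sum:
  "(\<And>i. i \<in> I \<Longrightarrow> simple_pole_part (f i) p) \<Longrightarrow> simple_pole_part (\<lambda>z. \<Sum>i\<in>I. f i z) p"
  by (induction I rule: infinite_finite_induct)
    (auto intro: simple_pole_part_add simple_pole_part_analytic)

lemma simple_pole_part_single: "simple_pole_part (\<lambda>z. w / (z - q)) p"
proof (cases "q = p")
  case True
  then show ?thesis unfolding simple_pole_part_def
    by (intro exI[of _ w] exI[of _ "\<lambda>_. 0"]) auto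
qed (auto intro!: simple_pole_part_analytic analytic_intros)

lemma meromorphic_on_simple_pole_part:
  assumes "simple_pole_part f p" shows "f meromorphic_on {p}"
proof -
  obtain u H where H: "H analytic_on {p}" and f: "\<forall>\<^sub>F z in at p. f z = u / (z - p) + H z"
    using assms unfolding simple_pole_part_def by blast
  have "(\<lambda>z. u / (z - p) + H z) meromorphic_on {p}"
    using H by (intro meromorphic_intros analytic_on_imp_meromorphic_on)
  then show ?thesis using f by (subst meromorphic_on_cong[where g = "\<lambda>z. u / (z - p) + H z"]) auto
qed

text \<open>At a pole \<open>u\<close> cannot be 0, since otherwise \<open>f\<close> would agree
  near \<open>p\<close> with the analytic \<open>H\<close>. Hence \<open>u + (z - p) * H z\<close>
  is the nonvanishing factor, and counting poles with multiplicity reduces to counting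
  points.\<close>

lemma zorder_simple_pole_part:
  assumes "simple_pole_part f p" "is_pole f p" shows "zorder f p = -1"
proof -
  obtain u H where H: "H analytic_on {p}" and f: "\<forall>\<^sub>F z in at p. f z = u / (z - p) + H z"
    using assms unfolding simple_pole_part_def by blast
  have u: "u \<noteq> 0"
  proof
    assume "u = 0"
    with f have "is_pole f p \<longleftrightarrow> is_pole H p" by (intro is_pole_cong) auto
    with assms(2) H show False using analytic_at_imp_no_pole by blast
  qed
  obtain A where A: "open A" "p \<in> A" "H holomorphic_on A" using H by (auto simp: analytic_at)
  obtain B where B: "open B" "p \<in> B" "\<And>z. z \<in> B \<Longrightarrow> z \<noteq> p \<Longrightarrow> f z = u / (z - p) + H z"
    using f by (auto simp: eventually_at_topological)
  show ?thesis
  proof (rule zorder_eqI[of "A \<inter> B" p "\<lambda>z. u + (z - p) * H z"])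
    fix z assume "z \<in> A \<inter> B" "z \<noteq> p"
    then show "f z = (u + (z - p) * H z) * (z - p) powi - 1"
      using B(3)[of z] by (simp add: add_divide_distrib field_simps)
  qed (use A B u in \<open>auto intro!: holomorphic_intros intro: holomorphic_on_subset\<close>)
qed

text \<open>Poles come in finite blocks, with \<open>x j\<close> a lower bound for the moduli in
  block \<open>j\<close>. Summable coefficients give convergence; summable square roots give a
  bounded proximity function.\<close>

locale pole_series =
  fixes x :: "nat \<Rightarrow> real" and I :: "nat \<Rightarrow> 'i set" and P w :: "nat \<Rightarrow> 'i \<Rightarrow> complex"
  assumes x_ge_1: "x j \<ge> 1" and x_lim: "filterlim x at_top sequentially"
    and finite_I: "finite (I j)" and norm_P: "i \<in> I j \<Longrightarrow> x j \<le> cmod (P j i)"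
    and summable_w: "summable (\<lambda>j. \<Sum>i\<in>I j. cmod (w j i))"
    and summable_sqrt_w: "summable (\<lambda>j. \<Sum>i\<in>I j. sqrt (cmod (w j i)))"
begin

definition T :: "nat \<Rightarrow> complex \<Rightarrow> complex" where
  "T j z = (\<Sum>i\<in>I j. w j i / (z - P j i))"

definition S :: "complex \<Rightarrow> complex" where "S z = (\<Sum>j. T j z)"

lemma norm_T_le:
  assumes "x j \<ge> R + 1" "cmod z \<le> R"
  shows "cmod (T j z) \<le> (\<Sum>i\<in>I j. cmod (w j i))"
  unfolding T_def
proof (rule sum_norm_le)
  fix i assume "i \<in> I j"
  then have "1 \<le> cmod (P j i) - cmod z" using assms norm_P[of i j] by auto
  also have "\<dots> \<le> cmod (z - P j i)" by (metis norm_minus_commute norm_triangle_ineq2)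
  finally have "cmod (w j i) / cmod (z - P j i) \<le> cmod (w j i) / 1"
    by (intro divide_left_mono) auto
  then show "cmod (w j i / (z - P j i)) \<le> cmod (w j i)" by (simp add: norm_divide)
qed

lemma norm_P_ge_1: "i \<in> I j \<Longrightarrow> cmod (P j i) \<ge> 1"
  using norm_P x_ge_1 order_trans by blast

lemma eventually_x_ge:
  "\<exists>J. \<forall>j\<ge>J. x j \<ge> R"
  using x_lim unfolding filterlim_at_top eventually_sequentially by blast

lemma finite_x_le: "finite {j. x j \<le> t}"
proof -
  obtain J where J: "\<And>j. j \<ge> J \<Longrightarrow> x j \<ge> t + 1" using eventually_x_ge by blast
  have "{j. x j \<le> t} \<subseteq> {..<J}" using J by (force simp: not_le[symmetric])
  then show ?thesis by (rule finite_subset) simp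
qed

lemma summable_T: "summable (\<lambda>j. T j z)"
proof -
  obtain J where "\<And>j. j \<ge> J \<Longrightarrow> x j \<ge> cmod z + 1" using eventually_x_ge by blast
  then show ?thesis by (intro summable_comparison_test[OF _ summable_w]) (use norm_T_le in blast)
qed

lemma S_split: "S z = (\<Sum>j<J. T j z) + (\<Sum>j. T (j + J) z)"
  using suminf_split_initial_segment[OF summable_T, of z J] by (simp add: S_def)

definition D :: real where "D = (\<Sum>j. \<Sum>i\<in>I j. cmod (w j i))"

lemma D_nonneg: "D \<ge> 0"
  unfolding D_def by (intro suminf_nonneg summable_w sum_nonneg) auto

text \<open>All poles of the tail are at distance at least 1 from \<open>z\<close>, so each term is
  bounded by its coefficient. The bound \<open>D\<close> depends on neither \<open>J\<close> nor
  \<open>R\<close>.\<close>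

lemma norm_tail_le:
  assumes "\<And>j. j \<ge> J \<Longrightarrow> x j \<ge> R + 1" "cmod z \<le> R"
  shows "cmod (\<Sum>j. T (j + J) z) \<le> D"
proof -
  have "cmod (\<Sum>j. T (j + J) z) \<le> (\<Sum>j. \<Sum>i\<in>I (j + J). cmod (w (j + J) i))"
    using assms summable_ignore_initial_segment[OF summable_w, of J]
    by (intro norm_suminf_le norm_T_le[of R]) auto
  also have "\<dots> \<le> D"
    using suminf_split_initial_segment[OF summable_w, of J] 
    by (auto simp: D_def intro!: sum_nonneg)
  finally show ?thesis .
qed

text \<open>The Weierstrass M-test gives uniform convergence on the ball of radius \<open>R\<close>,
  where no tail term has a pole.\<close>

lemma tail_analytic:
  assumes J: "\<And>j. j \<ge> J \<Longrightarrow> x j \<ge> R + 1" and p: "cmod p < R"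
  shows "(\<lambda>z. \<Sum>j. T (j + J) z) analytic_on {p}"
proof -
  have "(\<lambda>z. \<Sum>j. T (j + J) z) holomorphic_on ball 0 R"
  proof (rule holomorphic_uniform_sequence)
    show "(\<lambda>z. \<Sum>j<n. T (j + J) z) holomorphic_on ball 0 R" for n
    proof -
      have "z \<noteq> P (j + J) i" if "z \<in> ball 0 R" "i \<in> I (j + J)" for z j i
        using that norm_P[of i "j + J"] J[of "j + J"] by auto
      then show ?thesis unfolding T_def by (intro holomorphic_intros) auto
    qed
    have ul: "uniform_limit (ball 0 R) (\<lambda>n z. \<Sum>j<n. T (j + J) z) (\<lambda>z. \<Sum>j. T (j + J) z) sequentially"
      using J by (intro Weierstrass_m_test[of _ _ "\<lambda>j. \<Sum>i\<in>I (j + J). cmod (w (j + J) i)"] norm_T_le[of R])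
        (auto simp: summable_iff_shift[where f = "\<lambda>j. \<Sum>i\<in>I j. cmod (w j i)"] summable_w)
    fix z assume "z \<in> ball (0::complex) R"
    then obtain d where "d > 0" "cball z d \<subseteq> ball 0 R" using open_contains_cball open_ball by blast
    then show "\<exists>d>0. cball z d \<subseteq> ball 0 R \<and>
        uniform_limit (cball z d) (\<lambda>n z. \<Sum>j<n. T (j + J) z) (\<lambda>z. \<Sum>j. T (j + J) z) sequentially"
      using uniform_limit_on_subset[OF ul] by blast
  qed auto
  then show ?thesis using p by (auto simp: analytic_at intro!: exI[of _ "ball 0 R"])
qed

lemma simple_pole_part_S: "simple_pole_part S p"
proof -
  \<comment> \<open>With \<open>R = cmod p + 1\<close> the point \<open>p\<close> is interior to the
    disc; the second 1 is the distance from the disc to the poles of the tail.\<close>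
  obtain J where "\<And>j. j \<ge> J \<Longrightarrow> x j \<ge> (cmod p + 1) + 1" using eventually_x_ge by blast
  from tail_analytic[OF this] show ?thesis
    unfolding S_split[abs_def, of J] T_def[abs_def]
    by (intro simple_pole_part_add simple_pole_part_sum simple_pole_part_single
        simple_pole_part_analytic) auto
qed

lemma analytic_S:
  assumes "\<And>j i. i \<in> I j \<Longrightarrow> p \<noteq> P j i" shows "S analytic_on {p}"
proof -
  obtain J where "\<And>j. j \<ge> J \<Longrightarrow> x j \<ge> (cmod p + 1) + 1" using eventually_x_ge by blast
  from tail_analytic[OF this] show ?thesis
    unfolding S_split[abs_def, of J] using assms
    by (intro analytic_on_add) (auto simp: T_def intro!: analytic_intros)
qed

lemma meromorphic_S: "S meromorphic_on UNIV"
  by (subst meromorphic_on_meromorphic_at) (auto intro: meromorphic_on_simple_pole_part simple_pole_part_S)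

lemma is_pole_SD: "is_pole S p \<Longrightarrow> \<exists>j. \<exists>i\<in>I j. p = P j i"
  using analytic_S analytic_at_imp_no_pole by blast

text \<open>Only the finitely many blocks with \<open>x j \<le> cmod p + 1\<close> meet the ball of
  radius \<open>cmod p + 1\<close>, so the listed points do not accumulate at
  \<open>p\<close>.\<close>

lemma eventually_not_pole: "\<forall>\<^sub>F z in at p. \<forall>j. \<forall>i\<in>I j. z \<noteq> P j i"
proof -
  let ?A = "(\<Union>j\<in>{j. x j \<le> cmod p + 1}. P j ` I j) - {p}"
  have "finite ?A" using finite_x_le finite_I by auto
  then have "open (- ?A)" by (intro open_Compl finite_imp_closed)
  then have op: "open (- ?A \<inter> ball 0 (cmod p + 1))" by (intro open_Int open_ball)
  have "z \<noteq> P j i" if z: "z \<in> - ?A \<inter> ball 0 (cmod p + 1)" "z \<noteq> p" and i: "i \<in> I j" for z j i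
  proof
    assume eq: "z = P j i"
    have "x j \<le> cmod p + 1" using z norm_P[OF i] eq by auto
    then have "z \<in> ?A" using eq z i by auto
    with z(1) show False by blast
  qed
  then have "\<forall>z\<in>- ?A \<inter> ball 0 (cmod p + 1). z \<noteq> p \<longrightarrow> z \<in> UNIV \<longrightarrow> (\<forall>j. \<forall>i\<in>I j. z \<noteq> P j i)"
    by (intro ballI impI allI)
  moreover have "p \<in> - ?A \<inter> ball 0 (cmod p + 1)" by simp
  ultimately show ?thesis unfolding eventually_at_topological using op by (intro exI conjI)
qed

text \<open>Every pole of \<open>S\<close> is a listed point and is simple. Coinciding points or
  cancelling coefficients can only lower the count, so an inequality suffices.\<close>

lemma nev_n_S_le: "nev_n t S \<le> (\<Sum>j | x j \<le> t. real (card (I j)))"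
proof -
  let ?A = "{z. z \<in> cball 0 t \<and> is_pole S z}" and ?B = "\<Union>j\<in>{j. x j \<le> t}. P j ` I j"
  have sub: "?A \<subseteq> ?B"
  proof
    fix z assume z: "z \<in> ?A"
    then obtain j i where "i \<in> I j" "z = P j i" using is_pole_SD by blast
    moreover from this z have "x j \<le> t" using norm_P[of i j] by auto
    ultimately show "z \<in> ?B" by blast
  qed
  have fin: "finite ?B" using finite_x_le finite_I by auto
  have "nev_n t S = (\<Sum>z\<in>?A. 1)"
    unfolding nev_n_def by (intro sum.cong) (auto simp: zorder_simple_pole_part[OF simple_pole_part_S])
  also have "\<dots> \<le> real (card ?B)" using card_mono[OF fin sub] by simp
  also have "card ?B \<le> (\<Sum>j | x j \<le> t. card (P j ` I j))" by (rule card_UN_le[OF finite_x_le])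
  also have "\<dots> \<le> (\<Sum>j | x j \<le> t. card (I j))" by (intro sum_mono card_image_le finite_I)
  finally show ?thesis by simp
qed

lemma nev_n_S_eq_0: "t < 1 \<Longrightarrow> nev_n t S = 0"
proof -
  assume t: "t < 1"
  have "{z. z \<in> cball 0 t \<and> is_pole S z} = {}"
    using t is_pole_SD x_ge_1 norm_P by (fastforce dest: order_trans)
  then show ?thesis unfolding nev_n_def by (metis sum.empty)
qed

text \<open>The cut \<open>J\<close> depends on \<open>r\<close>, but the finite sums are bounded by
  the full series and the tail by \<open>D\<close>, so the estimate is uniform in
  \<open>r\<close>.\<close>

lemma nev_m_S_le:
  assumes "r \<ge> 1"
  shows "nev_m r S \<le> 100 * (\<Sum>j. \<Sum>i\<in>I j. sqrt (cmod (w j i))) + 2 * sqrt D"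
proof -
  obtain J where J: "\<And>j. j \<ge> J \<Longrightarrow> x j \<ge> r + 1" using eventually_x_ge by blast
  have "nev_m r S \<le> 100 * (\<Sum>k\<in>Sigma {..<J} I. sqrt (cmod (case k of (j, i) \<Rightarrow> w j i))) + 2 * sqrt D"
  proof (rule nev_m_le_pole_sum[where P = "\<lambda>(j, i). P j i"])
    fix z assume z: "cmod z = r"
    have "cmod (S z) \<le> cmod (\<Sum>j<J. T j z) + D"
      unfolding S_split[where z = z and J = J]
      by (rule norm_triangle_le) (use norm_tail_le[of J r z] J z in auto)
    also have "cmod (\<Sum>j<J. T j z) \<le> (\<Sum>j<J. \<Sum>i\<in>I j. cmod (w j i) / cmod (z - P j i))"
      unfolding T_def by (intro sum_norm_le) (auto simp: norm_divide)
    also have "\<dots> = (\<Sum>k\<in>Sigma {..<J} I. cmod (case k of (j, i) \<Rightarrow> w j i) / cmod (z - (case k of (j, i) \<Rightarrow> P j i)))"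
      by (subst sum.Sigma) (auto simp: finite_I split_def)
    finally show "cmod (S z) \<le> (\<Sum>k\<in>Sigma {..<J} I. cmod (case k of (j, i) \<Rightarrow> w j i) / cmod (z - (case k of (j, i) \<Rightarrow> P j i))) + D" by simp
  qed (use assms D_nonneg finite_I norm_P_ge_1 in auto)
  also have "(\<Sum>k\<in>Sigma {..<J} I. sqrt (cmod (case k of (j, i) \<Rightarrow> w j i))) = (\<Sum>j<J. \<Sum>i\<in>I j. sqrt (cmod (w j i)))"
    by (subst sum.Sigma) (auto simp: finite_I split_def)
  also have "\<dots> \<le> (\<Sum>j. \<Sum>i\<in>I j. sqrt (cmod (w j i)))"
    by (intro sum_le_suminf summable_sqrt_w) (auto intro: sum_nonneg)
  finally show ?thesis by simp
qed

end

section \<open>Partial fractions of a lacunary product\<close>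

lemma partial_fraction_two:
  fixes A B w :: complex
  assumes "A \<noteq> 0" "B \<noteq> 0" "A \<noteq> B" "w \<noteq> A" "w \<noteq> B"
  shows "1 / ((1 - w / A) * (1 - w / B)) = 1 / ((1 - w / A) * (1 - A / B)) + 1 / ((1 - w / B) * (1 - B / A))"
proof -
  define p q where "p = A - w" and "q = B - w"
  have nz: "p \<noteq> 0" "q \<noteq> 0" "q - p \<noteq> 0" using assms by (auto simp: p_def q_def)
  have eq: "1 - w / A = p / A" "1 - w / B = q / B" "1 - A / B = (q - p) / B" "1 - B / A = - (q - p) / A"
    using assms by (auto simp: p_def q_def diff_divide_distrib)
  have "1 / p - 1 / q = (q - p) / (p * q)" using nz by (simp add: diff_frac_eq)
  then have "A * B / (p * q) = A * B * (1 / p - 1 / q) / (q - p)" using nz by simp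
  also have "\<dots> = A * B / (p * (q - p)) + A * B / (q * (- (q - p)))"
    by (simp add: right_diff_distrib diff_divide_distrib del: minus_diff_eq)
  finally show ?thesis unfolding eq by (simp add: mult.commute del: minus_diff_eq)
qed

text \<open>Used with \<open>M j = 4 * x j ^ 4\<close> and the variable \<open>w = - z ^ 4\<close>,
  in which the denominator of \<open>g\<close> is the product of the factors
  \<open>1 - w / M j\<close>.\<close>

locale lacunary =
  fixes M :: "nat \<Rightarrow> real"
  assumes M_ge_1: "M i \<ge> 1" and M_Suc: "4 * M i \<le> M (Suc i)"
begin

lemma M_pos: "M i > 0" using M_ge_1[of i] by linarith

lemma M_add: "4 ^ n * M i \<le> M (i + n)"
proof (induction n)
  case (Suc n)
  then show ?case using M_Suc[of "i + n"] by simp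
qed simp

lemma M_less: "l < i \<Longrightarrow> 4 * M l \<le> M i"
proof -
  assume "l < i"
  then obtain n where i: "i = l + Suc n" using less_iff_Suc_add by auto
  have "4 * M l \<le> 4 ^ Suc n * M l" using M_pos[of l] by (intro mult_right_mono) auto
  then show ?thesis using M_add[of "Suc n" l] i by simp
qed

lemma M_inj: "M l = M i \<longleftrightarrow> l = i"
  using M_less[of l i] M_less[of i l] M_pos[of i] M_pos[of l] by (cases l i rule: linorder_cases) auto

text \<open>The coefficient at \<open>M i\<close> is the reciprocal of the product of
  \<open>1 - M i / M l\<close> over \<open>l \<noteq> i\<close>. The finite part
  \<open>l < i\<close>, kept in \<open>pre\<close>, carries the decay; the part \<open>l > i\<close>
  is a limit of the bounded products \<open>post i n\<close>.\<close>

definition pre :: "nat \<Rightarrow> real" where "pre i = (\<Prod>l<i. 1 / (1 - M i / M l))"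

definition post :: "nat \<Rightarrow> nat \<Rightarrow> real" where "post i n = (\<Prod>k<n. 1 / (1 - M i / M (i + Suc k)))"

definition coef :: "nat \<Rightarrow> real" where "coef i = pre i * lim (post i)"

lemma ratio_le: "M i / M (i + Suc k) \<le> (1 / 4) ^ Suc k"
  using M_add[of "Suc k" i] M_pos[of "i + Suc k"] by (simp add: field_simps)

lemma ratio_less_1: "0 < M i / M (i + Suc k)" "M i / M (i + Suc k) < 1"
proof -
  have "M i < M (i + Suc k)" using M_less[of i "i + Suc k"] M_pos[of i] by simp
  then show "0 < M i / M (i + Suc k)" "M i / M (i + Suc k) < 1"
    using M_pos[of i] M_pos[of "i + Suc k"] by auto
qed

text \<open>The product is at most 1, so factor \<open>n\<close> costs at most
  \<open>(1 / 4) ^ Suc n\<close>. These losses add up to less than \<open>1 / 3\<close>; the term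
  \<open>(1 / 3) * (1 / 4) ^ n\<close> is the part not yet spent.\<close>

lemma prod_ratio_ge: "(\<Prod>k<n. 1 - M i / M (i + Suc k)) \<ge> 2 / 3 + (1 / 3) * (1 / 4) ^ n"
proof (induction n)
  case (Suc n)
  let ?Q = "\<Prod>k<n. 1 - M i / M (i + Suc k)" and ?e = "M i / M (i + Suc n)"
  have "?Q \<le> 1" using ratio_less_1 by (intro prod_le_1) (auto intro: less_imp_le)
  then have "?Q * ?e \<le> 1 * (1 / 4) ^ Suc n"
    using ratio_le[of i n] ratio_less_1[of i n] by (intro mult_mono) auto
  then have "?Q - ?Q * ?e \<ge> 2 / 3 + (1 / 3) * (1 / 4) ^ Suc n" using Suc by simp
  then show ?case by (simp add: algebra_simps)
qed simp

lemma post_bounds: "0 < post i n" "post i n \<le> 2"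
proof -
  have eq: "post i n = 1 / (\<Prod>k<n. 1 - M i / M (i + Suc k))"
    unfolding post_def by (simp add: prod_dividef)
  have "(\<Prod>k<n. 1 - M i / M (i + Suc k)) \<ge> 1 / 2"
    by (rule order_trans[OF _ prod_ratio_ge]) (simp add: add_increasing2)
  then show "0 < post i n" "post i n \<le> 2" unfolding eq by (auto simp: field_simps)
qed

lemma post_LIMSEQ: "post i \<longlonglongrightarrow> lim (post i)"
proof -
  have "incseq (post i)"
  proof (rule incseq_SucI)
    fix n
    have "post i n * 1 \<le> post i n * (1 / (1 - M i / M (i + Suc n)))"
      using ratio_less_1[of i n] post_bounds[of i n] by (intro mult_left_mono) (auto simp: field_simps)
    then show "post i n \<le> post i (Suc n)" by (simp add: post_def)
  qed
  then have "convergent (post i)"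
    using incseq_convergent[of "post i" 2] post_bounds by (metis convergentI)
  then show ?thesis by (simp add: convergent_LIMSEQ_iff)
qed

lemma norm_coef_le: "\<bar>coef i\<bar> \<le> 2 * \<bar>pre i\<bar>"
proof -
  have "0 \<le> lim (post i)" "lim (post i) \<le> 2"
    using LIMSEQ_le_const[OF post_LIMSEQ] LIMSEQ_le_const2[OF post_LIMSEQ] post_bounds
    by (meson less_imp_le)+
  then have "\<bar>pre i\<bar> * \<bar>lim (post i)\<bar> \<le> \<bar>pre i\<bar> * 2" by (intro mult_left_mono) auto
  then show ?thesis by (simp add: coef_def abs_mult)
qed

lemma abs_factor_le:
  assumes "l < i"
  shows "\<bar>1 / (1 - M i / M l)\<bar> \<le> 1" "\<bar>1 / (1 - M i / M l)\<bar> \<le> 2 * M l / M i"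
proof -
  have "M i / M l \<ge> 4" using M_less[OF assms] M_pos[of l] by (simp add: field_simps)
  then have eq: "\<bar>1 / (1 - M i / M l)\<bar> = 1 / (M i / M l - 1)"
    and ge: "M i / M l - 1 \<ge> M i / M l / 2"
    and ge1: "M i / M l - 1 \<ge> 1" by (auto simp: abs_divide)
  show "\<bar>1 / (1 - M i / M l)\<bar> \<le> 1" unfolding eq using ge1 by (simp add: divide_le_eq_1)
  have "1 / (M i / M l - 1) \<le> 1 / (M i / M l / 2)"
  proof (rule divide_left_mono[OF ge])
    show "0 < (M i / M l - 1) * (M i / M l / 2)"
      by (rule mult_pos_pos) (use ge1 M_pos[of i] M_pos[of l] M_less[OF assms] in simp_all)
  qed simp
  then show "\<bar>1 / (1 - M i / M l)\<bar> \<le> 2 * M l / M i" unfolding eq by (simp add: mult.commute)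
qed

text \<open>Every factor of \<open>pre\<close> is at most 1 in modulus, and the decay of the last
  two is all that the later estimates use.\<close>

lemma abs_pre_le:
  "\<bar>pre (Suc (Suc k))\<bar> \<le> (2 * M k / M (Suc (Suc k))) * (2 * M (Suc k) / M (Suc (Suc k)))"
proof -
  let ?i = "Suc (Suc k)"
  let ?f = "\<lambda>l. 1 / (1 - M ?i / M l)"
  have "\<bar>\<Prod>l<k. ?f l\<bar> \<le> 1"
    unfolding abs_prod by (intro prod_le_1) (use abs_factor_le(1)[of _ ?i] in auto)
  then have "\<bar>\<Prod>l<k. ?f l\<bar> * \<bar>?f k\<bar> * \<bar>?f (Suc k)\<bar> \<le> 1 * (2 * M k / M ?i) * (2 * M (Suc k) / M ?i)"
    by (rule mult_mono[OF mult_mono[OF _ abs_factor_le(2)] abs_factor_le(2)])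
      (simp_all add: M_pos less_imp_le)
  then show ?thesis by (simp add: pre_def abs_mult)
qed

lemma partial_fractions:
  fixes w :: complex
  assumes "\<And>l. l \<le> J \<Longrightarrow> w \<noteq> M l"
  shows "1 / (\<Prod>l\<le>J. 1 - w / M l) = (\<Sum>i\<le>J. of_real (pre i * post i (J - i)) / (1 - w / M i))"
  using assms
proof (induction J arbitrary: w)
  case 0
  then show ?case by (simp add: pre_def post_def)
next
  case (Suc J)
  let ?B = "of_real (M (Suc J)) :: complex"
  have ne: "of_real (M i) \<noteq> ?B" if "i \<le> J" for i using that M_inj[of i "Suc J"] by auto
  have nz: "of_real (M i) \<noteq> (0::complex)" for i using M_pos[of i] by auto
  have post: "post i (Suc J - i) = post i (J - i) / (1 - M i / M (Suc J))" if "i \<le> J" for i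
    using that by (simp add: post_def Suc_diff_le)
  have "1 / (\<Prod>l\<le>Suc J. 1 - w / M l) = (1 / (\<Prod>l\<le>J. 1 - w / M l)) / (1 - w / ?B)" by simp
  also have "\<dots> = (\<Sum>i\<le>J. of_real (pre i * post i (J - i)) * (1 / ((1 - w / M i) * (1 - w / ?B))))"
    using Suc.IH[of w] Suc.prems by (simp add: sum_divide_distrib)
  also have "\<dots> = (\<Sum>i\<le>J. of_real (pre i * post i (J - i)) * (1 / ((1 - w / M i) * (1 - M i / ?B)))
      + of_real (pre i * post i (J - i)) * (1 / ((1 - w / ?B) * (1 - ?B / M i))))"
    using Suc.prems ne nz by (intro sum.cong refl) (subst partial_fraction_two, auto simp: ring_distribs)
  also have "\<dots> = (\<Sum>i\<le>J. of_real (pre i * post i (J - i)) * (1 / ((1 - w / M i) * (1 - M i / ?B))))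
      + (\<Sum>i\<le>J. of_real (pre i * post i (J - i)) / (1 - ?B / M i)) / (1 - w / ?B)"
    by (simp add: sum.distrib sum_divide_distrib mult.commute)
  \<comment> \<open>The coefficient at the new pole is the induction hypothesis evaluated at
    \<open>w = M (Suc J)\<close>; this is why \<open>w\<close> is arbitrary in the
    induction.\<close>
  also have "(\<Sum>i\<le>J. of_real (pre i * post i (J - i)) / (1 - ?B / M i)) = of_real (pre (Suc J))"
  proof -
    have "(\<Sum>i\<le>J. of_real (pre i * post i (J - i)) / (1 - ?B / M i)) = 1 / (\<Prod>l\<le>J. 1 - ?B / M l)"
      using ne by (intro Suc.IH[symmetric]) metis
    also have "\<dots> = of_real (pre (Suc J))" by (simp add: pre_def prod_dividef lessThan_Suc_atMost)
    finally show ?thesis .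
  qed
  also have "(\<Sum>i\<le>J. of_real (pre i * post i (J - i)) * (1 / ((1 - w / M i) * (1 - M i / ?B)))) = 
     (\<Sum>i\<le>J. of_real (pre i * post i (Suc J - i)) / (1 - w / M i))"
    by (intro sum.cong refl) (simp add: post)
  finally show ?case by (simp add: post_def)
qed

lemma summable_inverse_M: "summable (\<lambda>l. 1 / M l)"
proof (rule summable_comparison_test')
  show "summable (\<lambda>l. (1 / 4 :: real) ^ l)" by (intro summable_geometric) simp
  show "norm (1 / M l) \<le> (1 / 4) ^ l" if "l \<ge> 0" for l
  proof -
    have "4 ^ l * 1 \<le> 4 ^ l * M 0" using M_ge_1[of 0] by (intro mult_left_mono) auto
    also have "\<dots> \<le> M l" using M_add[of l 0] by simp
    finally have "4 ^ l \<le> M l" by simp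
    then show ?thesis using M_pos[of l] by (simp add: field_simps)
  qed
qed

text \<open>The coefficients of the finite expansions vary with \<open>J\<close>, so the passage to
  the limit is by Tannery's theorem. The dominating series is
  \<open>2 * |pre i| / |1 - w / M i|\<close>, whose denominators tend to 1.\<close>

lemma coef_expansion:
  fixes w :: complex
  assumes "\<And>l. w \<noteq> M l" and pre: "summable (\<lambda>i. \<bar>pre i\<bar>)"
  shows "(\<lambda>J. 1 / (\<Prod>l\<le>J. 1 - w / M l)) \<longlonglongrightarrow> (\<Sum>i. coef i / (1 - w / M i))"
proof -
  let ?y = "\<lambda>i. 1 - w / M i"
  define c where "c = (\<lambda>i J. if i \<le> J then of_real (pre i * post i (J - i)) / ?y i else 0)"
  have "(\<lambda>i. 1 - w * of_real (1 / M i)) \<longlonglongrightarrow> 1 - w * of_real 0"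
    by (intro tendsto_diff tendsto_mult tendsto_const tendsto_of_real summable_LIMSEQ_zero summable_inverse_M)
  then have "?y \<longlonglongrightarrow> 1" by simp
  from tendsto_divide[OF tendsto_const tendsto_norm[OF this], of 1]
  have "(\<lambda>i. 1 / cmod (?y i)) \<longlonglongrightarrow> 1" by simp
  then have "eventually (\<lambda>i. 1 / cmod (?y i) < 2) sequentially" by (intro order_tendstoD(2)) auto
  then have ev: "eventually (\<lambda>i. norm (2 * \<bar>pre i\<bar> * (1 / cmod (?y i))) \<le> 2 * \<bar>pre i\<bar> * 2) sequentially"
  proof eventually_elim
    case (elim i)
    then have "2 * \<bar>pre i\<bar> * (1 / cmod (?y i)) \<le> 2 * \<bar>pre i\<bar> * 2" by (intro mult_left_mono) auto
    then show ?case by simp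
  qed
  have sm: "summable (\<lambda>i. 2 * \<bar>pre i\<bar> * (1 / cmod (?y i)))"
    by (rule summable_comparison_test_ev[OF ev]) (intro summable_mult summable_mult2 pre)
  have lim: "(\<lambda>J. c i J) \<longlonglongrightarrow> of_real (coef i) / ?y i" for i
  proof -
    have "(\<lambda>n. of_real (pre i * post i n) / ?y i) \<longlonglongrightarrow> of_real (coef i) / ?y i"
      unfolding coef_def using assms(1)[of i] by (intro tendsto_intros post_LIMSEQ) (auto simp: field_simps)
    then have "(\<lambda>n. c i (n + i)) \<longlonglongrightarrow> of_real (coef i) / ?y i" by (simp add: c_def)
    then show ?thesis by (rule LIMSEQ_offset)
  qed
  have bd: "norm (c i J) \<le> 2 * \<bar>pre i\<bar> * (1 / cmod (?y i))" for i J
  proof (cases "i \<le> J")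
    case True
    have "\<bar>pre i\<bar> * post i (J - i) * (1 / cmod (?y i)) \<le> \<bar>pre i\<bar> * 2 * (1 / cmod (?y i))"
      using post_bounds by (intro mult_right_mono mult_left_mono) auto
    then show ?thesis using True post_bounds[of i "J - i"]
      by (simp add: c_def norm_divide norm_mult mult_ac)
  qed (simp add: c_def)
  have "(\<lambda>J. \<Sum>i. c i J) \<longlonglongrightarrow> (\<Sum>i. coef i / ?y i)"
    using tannerys_theorem[OF lim _ sm] bd by (auto simp: always_eventually split_def)
  also have "(\<lambda>J. \<Sum>i. c i J) = (\<lambda>J. \<Sum>i\<le>J. of_real (pre i * post i (J - i)) / ?y i)"
  proof
    fix J
    have "(\<Sum>i. c i J) = (\<Sum>i\<le>J. c i J)" by (rule suminf_finite) (auto simp: c_def)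
    then show "(\<Sum>i. c i J) = (\<Sum>i\<le>J. of_real (pre i * post i (J - i)) / ?y i)" by (simp add: c_def)
  qed
  also have "\<dots> = (\<lambda>J. 1 / (\<Prod>l\<le>J. 1 - w / M l))"
    using assms by (auto simp: partial_fractions)
  finally show ?thesis .
qed

text \<open>The sum is a limit of reciprocals of products, and \<open>1 + y \<le> exp y\<close>
  bounds these products from above. Factor \<open>i\<close> is kept apart because it becomes small
  as \<open>w\<close> approaches \<open>M i\<close>, which later forces a singularity there.\<close>

lemma coef_sum_lower_bound:
  fixes w :: complex
  assumes w: "\<And>l. w \<noteq> M l" and pre: "summable (\<lambda>i. \<bar>pre i\<bar>)"
  shows "1 \<le> cmod (\<Sum>j. coef j / (1 - w / M j)) * (cmod (1 - w / M i) * exp (cmod w * (\<Sum>l. 1 / M l)))"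
proof -
  let ?B = "cmod (1 - w / M i) * exp (cmod w * (\<Sum>l. 1 / M l))"
  let ?Q = "\<lambda>J. \<Prod>l\<le>J. 1 - w / of_real (M l)"
  have Q: "cmod (?Q J) \<le> ?B" if "i \<le> J" for J
  proof -
    have "cmod (?Q J) = cmod (1 - w / M i) * (\<Prod>l\<in>{..J} - {i}. cmod (1 - w / M l))"
      using that by (simp add: norm_mult prod_norm prod.remove[of _ i])
    also have "(\<Prod>l\<in>{..J} - {i}. cmod (1 - w / M l)) \<le> (\<Prod>l\<in>{..J} - {i}. exp (cmod w * (1 / M l)))"
    proof (intro prod_mono conjI)
      fix l
      have "cmod (1 - w / M l) \<le> 1 + cmod (w / M l)" by (metis norm_one norm_triangle_ineq4)
      also have "\<dots> = 1 + cmod w * (1 / M l)" using M_pos[of l] by (simp add: norm_divide)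
      also have "\<dots> \<le> exp (cmod w * (1 / M l))" by (rule exp_ge_add_one_self)
      finally show "cmod (1 - w / M l) \<le> exp (cmod w * (1 / M l))" .
    qed auto
    also have "\<dots> = exp (cmod w * (\<Sum>l\<in>{..J} - {i}. 1 / M l))"
      by (simp add: exp_sum sum_distrib_left)
    also have "\<dots> \<le> exp (cmod w * (\<Sum>l. 1 / M l))"
      using M_pos by (auto intro!: mult_left_mono sum_le_suminf summable_inverse_M simp: less_imp_le)
    finally show ?thesis by (simp add: mult_left_mono)
  qed
  have "1 \<le> cmod (1 / ?Q J) * ?B" if "i \<le> J" for J
  proof -
    have "1 - w / M l \<noteq> 0" for l using w[of l] M_pos[of l] by (auto simp: field_simps)
    then have "?Q J \<noteq> 0" by simp
    then have "1 = cmod (1 / ?Q J) * cmod (?Q J)" by (simp add: norm_divide)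
    also have "\<dots> \<le> cmod (1 / ?Q J) * ?B" using Q[OF that] by (intro mult_left_mono) auto
    finally show ?thesis .
  qed
  moreover have "(\<lambda>J. cmod (1 / ?Q J) * ?B) \<longlonglongrightarrow> cmod (\<Sum>j. coef j / (1 - w / M j)) * ?B"
    by (intro tendsto_intros coef_expansion assms)
  ultimately show ?thesis by (intro LIMSEQ_le_const) auto
qed

end

section \<open>Strings of poles\<close>

lemma four_poles_partial_fractions:
  fixes z X :: complex
  assumes "X \<noteq> 0" and nz: "z - (X + \<i> * X) \<noteq> 0" "z - (X - \<i> * X) \<noteq> 0"
    "z - (- X + \<i> * X) \<noteq> 0" "z - (- X - \<i> * X) \<noteq> 0"
  shows "- (\<i> * X\<^sup>2 / 2) * (1 / (z - (X + \<i> * X)) - 1 / (z - (X - \<i> * X))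
      - 1 / (z - (- X + \<i> * X)) + 1 / (z - (- X - \<i> * X))) = z / (1 + z ^ 4 / (4 * X ^ 4))"
    and "1 + z ^ 4 / (4 * X ^ 4) \<noteq> 0"
proof -
  let ?a = "z - (X + \<i> * X)" and ?b = "z - (X - \<i> * X)"
    and ?c = "z - (- X + \<i> * X)" and ?d = "z - (- X - \<i> * X)"
  have ii: "\<i> * \<i> = -1" by simp
  have p: "?a * ?b = (z - X)\<^sup>2 + X\<^sup>2" "?c * ?d = (z + X)\<^sup>2 + X\<^sup>2"
    using ii by algebra+
  \<comment> \<open>This is Sophie Germain's factorization of \<open>z ^ 4 + 4 * X ^ 4\<close>, each
    quadratic coming from a conjugate pair \<open>\<plusminus>\<i> * X\<close>.\<close>
  have q: "(?a * ?b) * (?c * ?d) = z ^ 4 + 4 * X ^ 4" unfolding p by algebra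
  then have ne: "z ^ 4 + 4 * X ^ 4 \<noteq> 0" using nz by (metis mult_eq_0_iff)
  have F: "1 + z ^ 4 / (4 * X ^ 4) = (z ^ 4 + 4 * X ^ 4) / (4 * X ^ 4)"
    using assms(1) by (simp add: field_simps)
  then show "1 + z ^ 4 / (4 * X ^ 4) \<noteq> 0" using ne assms(1) by simp
  have 1: "1 / ?a - 1 / ?b = 2 * \<i> * X / (?a * ?b)"
    using nz by (simp add: diff_frac_eq)
  have 2: "1 / ?d - 1 / ?c = - (2 * \<i> * X) / (?c * ?d)"
    using nz by (simp add: diff_frac_eq mult.commute)
  have diff: "N / u - N / v = N * (v - u) / (u * v)" if "u \<noteq> 0" "v \<noteq> 0" for N u v :: complex
    using that by (simp add: diff_frac_eq right_diff_distrib)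
  have 3: "2 * \<i> * X / (?a * ?b) - 2 * \<i> * X / (?c * ?d)
      = (2 * \<i> * X) * (?c * ?d - ?a * ?b) / (z ^ 4 + 4 * X ^ 4)"
    unfolding q[symmetric] by (rule diff) (simp_all only: mult_eq_0_iff nz simp_thms)
  have 4: "?c * ?d - ?a * ?b = 4 * z * X" unfolding p by algebra
  have "1 / ?a - 1 / ?b - 1 / ?c + 1 / ?d = (1 / ?a - 1 / ?b) + (1 / ?d - 1 / ?c)" by simp
  also have "\<dots> = 2 * \<i> * X / (?a * ?b) - 2 * \<i> * X / (?c * ?d)" unfolding 1 2 by simp
  also have "\<dots> = (2 * \<i> * X) * (4 * z * X) / (z ^ 4 + 4 * X ^ 4)" unfolding 3 4 ..
  finally have "- (\<i> * X\<^sup>2 / 2) * (1 / ?a - 1 / ?b - 1 / ?c + 1 / ?d)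
      = - (\<i> * X\<^sup>2 / 2) * ((2 * \<i> * X) * (4 * z * X)) / (z ^ 4 + 4 * X ^ 4)" by simp
  also have "- (\<i> * X\<^sup>2 / 2) * ((2 * \<i> * X) * (4 * z * X)) = z * (4 * X ^ 4)"
    using ii by (simp add: power2_eq_square eval_nat_numeral)
  finally show "- (\<i> * X\<^sup>2 / 2) * (1 / ?a - 1 / ?b - 1 / ?c + 1 / ?d) = z / (1 + z ^ 4 / (4 * X ^ 4))"
    unfolding F using assms(1) by simp
qed

lemma sum_times_signs:
  fixes h :: "'a \<times> complex \<Rightarrow> complex"
  shows "(\<Sum>i\<in>A \<times> {1, -1}. h i) = (\<Sum>a\<in>A. h (a, 1) + h (a, -1))"
proof -
  have "(\<Sum>i\<in>A \<times> {1, -1}. h i) = (\<Sum>a\<in>A. \<Sum>s\<in>{1, -1}. h (a, s))"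
    by (rule sum.cartesian_product')
  then show ?thesis by simp
qed

section \<open>Sparse sequences and decay of the coefficients\<close>

locale sparse_strings =
  fixes x :: "nat \<Rightarrow> nat"
  assumes x_0: "x 0 \<ge> 2" and x_Suc: "x j ^ 4 \<le> x (Suc j)"
begin

lemma x_ge_2: "x j \<ge> 2"
proof (induction j)
  case (Suc j)
  then have "x j ^ 1 \<le> x j ^ 4" by (intro power_increasing) auto
  then show ?case using Suc x_Suc[of j] by simp
qed (rule x_0)

lemma x_double: "2 * x j \<le> x (Suc j)"
proof -
  have "2 * x j \<le> x j * x j" using x_ge_2[of j] by (intro mult_right_mono) auto
  also have "\<dots> = x j ^ 2" by (simp add: power2_eq_square)
  also have "\<dots> \<le> x j ^ 4" using x_ge_2[of j] by (intro power_increasing) auto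
  finally show ?thesis using x_Suc[of j] by simp
qed

lemma strict_mono_x: "strict_mono x"
  unfolding strict_mono_Suc_iff
proof
  fix j show "x j < x (Suc j)" using x_double[of j] x_ge_2[of j] by linarith
qed

lemma x_ge_power: "2 ^ Suc j \<le> x j"
proof (induction j)
  case (Suc j) then show ?case using x_double[of j] by simp
qed (use x_0 in simp)

lemma x_ge_index: "Suc j \<le> x j"
  using x_ge_power[of j] less_exp[of "Suc j"] by linarith

lemma power4_le: "l < i \<Longrightarrow> x l ^ 4 \<le> x i"
proof -
  assume "l < i"
  then have "x (Suc l) \<le> x i" using strict_mono_x by (simp add: strict_mono_less_eq)
  then show ?thesis using x_Suc[of l] by simp
qed

lemma sum_x_le: "(\<Sum>j\<le>n. x j) \<le> 2 * x n"
proof (induction n)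
  case (Suc n) then show ?case using x_double[of n] by simp
qed simp

lemma real_x_pos: "real (x j) \<ge> 1" "real (x j) > 0" using x_ge_2[of j] by auto

lemma x_ge_1: "Suc 0 \<le> x j" using x_ge_2[of j] by simp

lemma x_lim: "filterlim (\<lambda>j. real (x j)) at_top sequentially"
  by (intro filterlim_compose[OF filterlim_real_sequentially] filterlim_subseq strict_mono_x)

lemma lacunary_x: "lacunary (\<lambda>j. 4 * real (x j) ^ 4)"
proof
  show "4 * real (x i) ^ 4 \<ge> 1" for i
    using one_le_power[OF real_x_pos(1)[of i], of 4] by linarith
  show "4 * (4 * real (x i) ^ 4) \<le> 4 * real (x (Suc i)) ^ 4" for i
  proof -
    have "(2 * x i) ^ 4 \<le> x (Suc i) ^ 4" using x_double by (intro power_mono) auto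
    then have "real ((2 * x i) ^ 4) \<le> real (x (Suc i) ^ 4)" by (rule of_nat_mono)
    then have "16 * real (x i) ^ 4 \<le> real (x (Suc i)) ^ 4" by (simp add: power_mult_distrib)
    moreover have "real (x i) ^ 4 \<ge> 0" by simp
    ultimately show ?thesis by linarith
  qed
qed

abbreviation "pre \<equiv> lacunary.pre (\<lambda>j. 4 * real (x j) ^ 4)"
abbreviation "coef \<equiv> lacunary.coef (\<lambda>j. 4 * real (x j) ^ 4)"

text \<open>The growth condition gives \<open>x l ^ 4 \<le> x i\<close> for \<open>l < i\<close>, so
  each of the last two factors of \<open>pre i\<close> is at most
  \<open>2 / x i ^ 3\<close>.\<close>

lemma abs_pre_le_x: 
  assumes "i \<ge> 2" shows "\<bar>pre i\<bar> \<le> 4 / real (x i) ^ 6"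
proof -
  obtain k where i: "i = Suc (Suc k)" using assms by (metis add_2_eq_Suc le_Suc_ex)
  define X where "X = real (x i)"
  have X: "X > 0" using real_x_pos by (simp add: X_def)
  have le: "2 * (4 * real (x l) ^ 4) / (4 * X ^ 4) \<le> 2 / X ^ 3" if "l < i" for l
  proof -
    have "real (x l) ^ 4 \<le> X" unfolding X_def using of_nat_mono[where 'a = real, OF power4_le[OF that]] by (simp only: of_nat_power)
    then have "2 * (4 * real (x l) ^ 4) / (4 * X ^ 4) \<le> 2 * (4 * X) / (4 * X ^ 4)"
      using X by (intro divide_right_mono) auto
    also have "\<dots> = 2 / X ^ 3" using X by (simp add: eval_nat_numeral)
    finally show ?thesis .
  qed
  have "\<bar>pre i\<bar> \<le> (2 * (4 * real (x k) ^ 4) / (4 * X ^ 4)) * (2 * (4 * real (x (Suc k)) ^ 4) / (4 * X ^ 4))"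
    using lacunary.abs_pre_le[OF lacunary_x, of k] by (simp add: i X_def)
  also have "\<dots> \<le> (2 / X ^ 3) * (2 / X ^ 3)" using X i by (intro mult_mono le) auto
  also have "\<dots> = 4 / X ^ 6" by (simp flip: power_add)
  finally show ?thesis by (simp add: X_def)
qed

lemma summable_inverse_x: "summable (\<lambda>j. 1 / real (x j))"
proof (rule summable_comparison_test')
  show "summable (\<lambda>l. (1 / 2 :: real) ^ l)" by (intro summable_geometric) simp
  show "norm (1 / real (x l)) \<le> (1 / 2) ^ l" if "l \<ge> 0" for l
  proof -
    have "2 ^ l \<le> x l" using x_ge_power[of l] by simp
    then have "real (2 ^ l) \<le> real (x l)" by (rule of_nat_mono)
    then show ?thesis using real_x_pos(2)[of l] by (simp add: field_simps)
  qed
qed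

lemma summable_pre: "summable (\<lambda>i. \<bar>pre i\<bar>)"
proof (rule summable_comparison_test)
  show "summable (\<lambda>i. 4 * (1 / real (x i)))" by (intro summable_mult summable_inverse_x)
  show "\<exists>N. \<forall>i\<ge>N. norm \<bar>pre i\<bar> \<le> 4 * (1 / real (x i))"
  proof (intro exI[of _ 2] allI impI)
    fix i :: nat assume "i \<ge> 2"
    have "real (x i) ^ 1 \<le> real (x i) ^ 6" using real_x_pos by (intro power_increasing) auto
    then have "4 / real (x i) ^ 6 \<le> 4 / real (x i)"
      using real_x_pos(2)[of i] by (intro divide_left_mono) auto
    then show "norm \<bar>pre i\<bar> \<le> 4 * (1 / real (x i))" using abs_pre_le_x[OF \<open>i \<ge> 2\<close>] by simp
  qed
qed

definition weight :: "nat \<Rightarrow> real" where "weight j = \<bar>coef j\<bar> * real (x j) ^ 2 / 2"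

lemma weight_nonneg: "weight j \<ge> 0" by (simp add: weight_def)

lemma weight_le:
  assumes "j \<ge> 2" shows "weight j \<le> 4 / real (x j) ^ 4"
proof -
  have "weight j \<le> 2 * (4 / real (x j) ^ 6) * real (x j) ^ 2 / 2"
    unfolding weight_def using lacunary.norm_coef_le[OF lacunary_x, of j] abs_pre_le_x[OF assms]
    by (intro divide_right_mono mult_right_mono) auto
  also have "\<dots> = 4 / real (x j) ^ 4" using real_x_pos(2)[of j] by (simp add: eval_nat_numeral)
  finally show ?thesis .
qed

text \<open>The weight decays like \<open>x j ^ (-4)\<close> and its root like
  \<open>x j ^ (-2)\<close>. Even with \<open>4 * x j\<close> poles in a block, a multiple of the
  summable \<open>1 / x j\<close> dominates.\<close>

lemma summable_weight:
  assumes n: "\<And>j. n j \<le> 4 * x j"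
  shows "summable (\<lambda>j. real (n j) * weight j)" "summable (\<lambda>j. real (n j) * sqrt (weight j))"
proof -
  have le: "real (n j) * v \<le> 16 * (1 / real (x j))" if "0 \<le> v" "v \<le> 4 / real (x j) ^ 2" for j v
  proof -
    have "real (n j) \<le> 4 * real (x j)" using n[of j] by linarith
    then have "real (n j) * v \<le> (4 * real (x j)) * (4 / real (x j) ^ 2)"
      using that by (intro mult_mono) auto
    then show ?thesis using real_x_pos(2)[of j] by (simp add: power2_eq_square)
  qed
  have sm: "summable (\<lambda>i. 16 * (1 / real (x i)))" by (intro summable_mult summable_inverse_x)
  have w1: "weight j \<le> 4 / real (x j) ^ 2" if "j \<ge> 2" for j
  proof -
    have "real (x j) ^ 2 \<le> real (x j) ^ 4" using real_x_pos by (intro power_increasing) auto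
    then have "4 / real (x j) ^ 4 \<le> 4 / real (x j) ^ 2"
      using real_x_pos(2)[of j] by (intro divide_left_mono) auto
    then show ?thesis using weight_le[OF that] by simp
  qed
  have w2: "sqrt (weight j) \<le> 4 / real (x j) ^ 2" if "j \<ge> 2" for j
  proof -
    have "weight j \<le> (2 / real (x j) ^ 2)\<^sup>2"
      using weight_le[OF that] by (simp add: power_divide flip: power_mult)
    then have "sqrt (weight j) \<le> 2 / real (x j) ^ 2" by (intro real_le_lsqrt) auto
    also have "\<dots> \<le> 4 / real (x j) ^ 2" by (intro divide_right_mono) auto
    finally show ?thesis .
  qed
  show "summable (\<lambda>j. real (n j) * weight j)"
    by (rule summable_comparison_test[OF _ sm])
      (use le[OF weight_nonneg w1] weight_nonneg in \<open>auto intro!: exI[of _ 2]\<close>)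
  show "summable (\<lambda>j. real (n j) * sqrt (weight j))"
    by (rule summable_comparison_test[OF _ sm])
      (use le[OF _ w2] weight_nonneg in \<open>auto intro!: exI[of _ 2]\<close>)
qed

text \<open>The poles of \<open>f\<close> form, for each \<open>j\<close>, two horizontal strings of unit step at heights \<open>\<plusminus>x j\<close>, running from
  real part \<open>x j\<close> down to \<open>1 - x j\<close>; the poles of \<open>g\<close> are the four corners \<open>\<plusminus>x j \<plusminus> \<i> x j\<close>.
  The letters \<open>e\<close> and \<open>s\<close> are signs.\<close>

definition idx_f :: "nat \<Rightarrow> (nat \<times> complex) set" where "idx_f j = {..<2 * x j} \<times> {1, -1}"
definition pole_f :: "nat \<Rightarrow> nat \<times> complex \<Rightarrow> complex" where
  "pole_f j = (\<lambda>(k, s). of_nat (x j) - of_nat k + s * \<i> * of_nat (x j))"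
definition wt_f :: "nat \<Rightarrow> nat \<times> complex \<Rightarrow> complex" where
  "wt_f j = (\<lambda>(k, s). of_real (coef j) * of_nat (x j) ^ 2 / 2 * \<i> * s)"

definition idx_g :: "nat \<Rightarrow> (complex \<times> complex) set" where "idx_g j = {1, -1} \<times> {1, -1}"
definition pole_g :: "nat \<Rightarrow> complex \<times> complex \<Rightarrow> complex" where
  "pole_g j = (\<lambda>(e, s). e * of_nat (x j) + s * \<i> * of_nat (x j))"
definition wt_g :: "nat \<Rightarrow> complex \<times> complex \<Rightarrow> complex" where
  "wt_g j = (\<lambda>(e, s). - e * (of_real (coef j) * of_nat (x j) ^ 2 / 2 * \<i> * s))"

lemma card_idx_f: "card (idx_f j) = 4 * x j" and finite_idx_f: "finite (idx_f j)"
  by (auto simp: idx_f_def card_cartesian_product)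

lemma card_idx_g: "card (idx_g j) = 4" and finite_idx_g: "finite (idx_g j)"
  by (auto simp: idx_g_def card_cartesian_product)

lemma norm_wt_f: "i \<in> idx_f j \<Longrightarrow> cmod (wt_f j i) = weight j"
  and norm_wt_g: "i' \<in> idx_g j \<Longrightarrow> cmod (wt_g j i') = weight j"
  by (auto simp: idx_f_def wt_f_def idx_g_def wt_g_def weight_def norm_mult norm_divide norm_power)

lemma norm_pole_f: "i \<in> idx_f j \<Longrightarrow> real (x j) \<le> cmod (pole_f j i)"
  and norm_pole_g: "i' \<in> idx_g j \<Longrightarrow> real (x j) \<le> cmod (pole_g j i')"
  by (rule order_trans[OF _ abs_Im_le_cmod]; auto simp: idx_f_def pole_f_def idx_g_def pole_g_def)+

lemma series_f: "pole_series (\<lambda>j. real (x j)) idx_f pole_f wt_f"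
  using summable_weight[of "\<lambda>j. card (idx_f j)"] 
  by unfold_locales (auto simp: x_lim finite_idx_f norm_pole_f norm_wt_f card_idx_f x_ge_1)

lemma series_g: "pole_series (\<lambda>j. real (x j)) idx_g pole_g wt_g"
proof -
  have "card (idx_g j) \<le> 4 * x j" for j using x_ge_2[of j] by (simp add: card_idx_g)
  then show ?thesis
    using summable_weight[of "\<lambda>j. card (idx_g j)"]
    by unfold_locales (auto simp: x_lim finite_idx_g norm_pole_g norm_wt_g x_ge_1)
qed

abbreviation "f_term \<equiv> pole_series.T idx_f pole_f wt_f"
abbreviation "f \<equiv> pole_series.S idx_f pole_f wt_f"
abbreviation "g_term \<equiv> pole_series.T idx_g pole_g wt_g"
abbreviation "g \<equiv> pole_series.S idx_g pole_g wt_g"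

text \<open>The identity holds even at the poles, because \<open>1 / (z + 1 - p)\<close> and \<open>1 / (z - (p - 1))\<close> have the
  same junk value.\<close>
lemma difference_T: "f_term j (z + 1) - f_term j z = g_term j z"
proof -
  define X where "X = (of_nat (x j) :: complex)"
  define c where "c = of_real (coef j) * X ^ 2 / 2 * \<i>"
  define F where "F = (\<lambda>s k. c * s / (z - (X - of_nat k + s * \<i> * X)))"
  have f: "f_term j (z + d) = (\<Sum>k<2 * x j. c * 1 / (z + d - (X - of_nat k + 1 * \<i> * X))
      + c * -1 / (z + d - (X - of_nat k + -1 * \<i> * X)))" for d
    unfolding pole_series.T_def[OF series_f] idx_f_def sum_times_signs wt_f_def pole_f_def c_def X_def prod.case ..
  have F: "c * s / (z + 1 - (X - of_nat k + s * \<i> * X)) = F s (Suc k)"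
    "c * s / (z + 0 - (X - of_nat k + s * \<i> * X)) = F s k" for s k
    unfolding F_def by (simp_all add: algebra_simps)
  have "f_term j (z + 1) - f_term j (z + 0) = (\<Sum>k<2 * x j. (F 1 (Suc k) - F 1 k) + (F (-1) (Suc k) - F (-1) k))"
    unfolding f F sum_subtractf[symmetric] by (rule sum.cong) simp_all
  \<comment> \<open>The index \<open>k = 0\<close> has real part \<open>x j\<close> and
    \<open>k = 2 * x j\<close> has real part \<open>- x j\<close>; with both signs these ends are
    the four corners.\<close>
  also have "\<dots> = (F 1 (2 * x j) - F 1 0) + (F (-1) (2 * x j) - F (-1) 0)"
    unfolding sum.distrib sum_lessThan_telescope ..
  also have "\<dots> = g_term j z"
  proof -
    have "g_term j z = - (c / (z - (X + \<i> * X))) + c / (z - (X - \<i> * X))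
        + (c / (z - (- X + \<i> * X)) - c / (z - (- X - \<i> * X)))"
      unfolding pole_series.T_def[OF series_g] idx_g_def sum_times_signs wt_g_def pole_g_def prod.case X_def c_def by simp
    moreover have "F 1 (2 * x j) = c / (z - (- X + \<i> * X))" "F 1 0 = c / (z - (X + \<i> * X))"
      "F (-1) (2 * x j) = - c / (z - (- X - \<i> * X))" "F (-1) 0 = - c / (z - (X - \<i> * X))"
      by (simp_all add: F_def X_def)
    ultimately show ?thesis by simp
  qed
  finally have "f_term j (z + 1) - f_term j (z + 0) = g_term j z" .
  then show ?thesis by simp
qed

lemma difference_S: "f (z + 1) - f z = g z"
  unfolding pole_series.S_def[OF series_f] pole_series.S_def[OF series_g] difference_T[symmetric]
  by (rule suminf_diff[OF pole_series.summable_T[OF series_f] pole_series.summable_T[OF series_f]])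

text \<open>\<open>four_poles_partial_fractions\<close> identifies the block with \<open>z\<close>
  times a term of the expansion at \<open>w = - z ^ 4\<close>. The second claim is the hypothesis
  under which that expansion is valid.\<close>

lemma g_T_eq:
  fixes z :: complex
  assumes "\<And>i. i \<in> idx_g j \<Longrightarrow> z \<noteq> pole_g j i"
  shows "g_term j z = z * (coef j / (1 - (- (z ^ 4)) / of_real (4 * real (x j) ^ 4)))"
    and "- (z ^ 4) \<noteq> of_real (4 * real (x j) ^ 4)"
proof -
  define X where "X = (of_nat (x j) :: complex)"
  have X: "X \<noteq> 0" using x_ge_2[of j] by (simp add: X_def)
  have nz: "z - (X + \<i> * X) \<noteq> 0" "z - (X - \<i> * X) \<noteq> 0"
    "z - (- X + \<i> * X) \<noteq> 0" "z - (- X - \<i> * X) \<noteq> 0"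
    using assms[of "(1, 1)"] assms[of "(1, -1)"] assms[of "(-1, 1)"] assms[of "(-1, -1)"]
    by (auto simp: idx_g_def pole_g_def X_def)
  have "g_term j z = of_real (coef j) * (- (\<i> * X\<^sup>2 / 2) * (1 / (z - (X + \<i> * X)) - 1 / (z - (X - \<i> * X))
      - 1 / (z - (- X + \<i> * X)) + 1 / (z - (- X - \<i> * X))))"
  proof -
    define c where "c = of_real (coef j) * X ^ 2 / 2 * \<i>"
    have "g_term j z = - (c / (z - (X + \<i> * X))) + c / (z - (X - \<i> * X))
        + (c / (z - (- X + \<i> * X)) - c / (z - (- X - \<i> * X)))"
      unfolding pole_series.T_def[OF series_g] idx_g_def sum_times_signs wt_g_def pole_g_def prod.case X_def c_def by simp
    then show ?thesis by (simp add: c_def algebra_simps diff_divide_distrib add_divide_distrib)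
  qed
  also have "\<dots> = of_real (coef j) * (z / (1 + z ^ 4 / (4 * X ^ 4)))"
    by (simp only: four_poles_partial_fractions(1)[OF X nz])
  finally show "g_term j z = z * (coef j / (1 - (- (z ^ 4)) / of_real (4 * real (x j) ^ 4)))"
    by (simp add: X_def)
  show "- (z ^ 4) \<noteq> of_real (4 * real (x j) ^ 4)"
  proof
    assume "- (z ^ 4) = of_real (4 * real (x j) ^ 4)"
    then have "- (z ^ 4) = 4 * X ^ 4" by (simp add: X_def)
    then have "z ^ 4 = - (4 * X ^ 4)" by (metis minus_minus)
    then have "1 + z ^ 4 / (4 * X ^ 4) = 0" using X by simp
    with four_poles_partial_fractions(2)[OF X nz] show False by simp
  qed
qed

section \<open>The zero of \<open>g\<close> and transcendence of \<open>f\<close>\<close>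

lemma g_lower_bound:
  assumes "\<forall>j. \<forall>i\<in>idx_g j. z \<noteq> pole_g j i"
  shows "cmod z \<le> cmod (g z) * (cmod (1 + z ^ 4 / of_real (4 * real (x i) ^ 4)) *
    exp (cmod z ^ 4 * (\<Sum>l. 1 / (4 * real (x l) ^ 4))))"
proof (cases "z = 0")
  case False
  let ?s = "\<lambda>j. coef j / (1 - (- (z ^ 4)) / of_real (4 * real (x j) ^ 4))"
  have T: "g_term j z = z * ?s j" for j by (rule g_T_eq(1)) (use assms in auto)
  have "summable (\<lambda>j. z * ?s j)" using pole_series.summable_T[OF series_g, of z] unfolding T .
  then have "summable ?s" using False summable_cmult_iff[of z ?s] by blast
  then have S: "g z = z * (\<Sum>j. ?s j)" unfolding pole_series.S_def[OF series_g] T by (rule suminf_mult)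
  have "cmod z * 1 \<le> cmod z * (cmod (\<Sum>j. ?s j) * (cmod (1 - (- (z ^ 4)) / of_real (4 * real (x i) ^ 4)) *
      exp (cmod (- (z ^ 4)) * (\<Sum>l. 1 / (4 * real (x l) ^ 4)))))"
    by (intro mult_left_mono lacunary.coef_sum_lower_bound[OF lacunary_x] summable_pre g_T_eq(2)) (use assms in auto)
  then show ?thesis by (simp add: S norm_mult norm_power mult.assoc)
qed simp

text \<open>The lower bound survives the limit even at a corner. A limit \<open>L = 0\<close> forces
  \<open>p = 0\<close>, and at a corner of block \<open>i\<close> the vanishing factor excludes
  every finite limit.\<close>

lemma g_limit_bound:
  assumes lim: "(g \<longlongrightarrow> L) (at p)"
  shows "cmod p \<le> cmod L * (cmod (1 + p ^ 4 / of_real (4 * real (x i) ^ 4)) *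
    exp (cmod p ^ 4 * (\<Sum>l. 1 / (4 * real (x l) ^ 4))))"
proof (rule tendsto_le)
  show "((\<lambda>z. cmod (g z) * (cmod (1 + z ^ 4 / of_real (4 * real (x i) ^ 4)) *
      exp (cmod z ^ 4 * (\<Sum>l. 1 / (4 * real (x l) ^ 4))))) \<longlongrightarrow>
      cmod L * (cmod (1 + p ^ 4 / of_real (4 * real (x i) ^ 4)) *
      exp (cmod p ^ 4 * (\<Sum>l. 1 / (4 * real (x l) ^ 4))))) (at p)"
    using x_ge_2[of i] by (intro tendsto_intros lim) auto
  show "((\<lambda>z. cmod z) \<longlongrightarrow> cmod p) (at p)" by (intro tendsto_intros)
  show "\<forall>\<^sub>F z in at p. cmod z \<le> cmod (g z) * (cmod (1 + z ^ 4 / of_real (4 * real (x i) ^ 4)) *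
      exp (cmod z ^ 4 * (\<Sum>l. 1 / (4 * real (x l) ^ 4))))"
    by (rule eventually_mono[OF pole_series.eventually_not_pole[OF series_g] g_lower_bound])
qed simp

lemma mero_zeros_g: "mero_zeros g = {0}"
proof -
  have "\<not> (g \<longlongrightarrow> 0) (at p)" if "p \<noteq> 0" for p
  proof
    assume lim: "(g \<longlongrightarrow> 0) (at p)"
    from g_limit_bound[OF lim] have "cmod p \<le> 0" by (simp only: norm_zero mult_zero_left)
    then show False using that by simp
  qed
  moreover have "(g \<longlongrightarrow> 0) (at 0)"
  proof -
    have np: "0 \<noteq> pole_g j i" if "i \<in> idx_g j" for i j using pole_series.norm_P_ge_1[OF series_g that] by auto
    then have "isCont g 0" by (intro analytic_at_imp_isCont pole_series.analytic_S[OF series_g])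
    moreover have "g_term j 0 = 0" for j by (subst g_T_eq(1)) (use np in auto)
    then have "g 0 = 0" by (simp add: pole_series.S_def[OF series_g])
    ultimately show ?thesis by (metis isCont_def)
  qed
  ultimately show ?thesis unfolding mero_zeros_def by auto
qed

text \<open>If \<open>f\<close> were \<open>p / q\<close>, then \<open>g\<close> would have a finite
  limit wherever \<open>q(w) * q(w + 1)\<close> is nonzero. It has none at the corners, so this
  nonzero polynomial would have infinitely many roots.\<close>

lemma not_rational_f: "\<not> rational_fun f"
proof
  assume "rational_fun f"
  then obtain p q where q: "q \<noteq> 0" and f: "\<And>z. \<forall>\<^sub>F w in at z. f w = poly p w / poly q w"
    unfolding rational_fun_def by blast
  define Q where "Q = q * pcompose q [:1, 1:]"
  have Q: "poly Q w = poly q w * poly q (w + 1)" for w by (simp add: Q_def poly_pcompose add.commute)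
  have "Q \<noteq> 0" using q by (auto simp: Q_def pcompose_eq_0_iff)
  then have fin: "finite {w. poly Q w = 0}" by (rule poly_roots_finite)
  define c where "c = (\<lambda>i. pole_g i (1, 1))"
  have "poly Q (c i) = 0" for i
  proof (rule ccontr)
    assume "poly Q (c i) \<noteq> 0"
    then have nz: "poly q (c i) \<noteq> 0" "poly q (c i + 1) \<noteq> 0" by (auto simp: Q)
    have "filterlim (\<lambda>w. w + 1) (at (c i + 1)) (at (c i))"
      by (auto simp: filterlim_at eventually_at_topological intro!: tendsto_intros)
    then have "\<forall>\<^sub>F w in at (c i). f (w + 1) = poly p (w + 1) / poly q (w + 1)"
      by (rule eventually_compose_filterlim[OF f])
    then have g: "\<forall>\<^sub>F w in at (c i). poly p (w + 1) / poly q (w + 1) - poly p w / poly q w = g w"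
      using f[of "c i"] by eventually_elim (simp flip: difference_S)
    have "((\<lambda>w. poly p (w + 1) / poly q (w + 1) - poly p w / poly q w) \<longlongrightarrow>
        poly p (c i + 1) / poly q (c i + 1) - poly p (c i) / poly q (c i)) (at (c i))"
      using nz by (intro tendsto_intros) auto
    from Lim_transform_eventually[OF this g]
    obtain L where L: "(g \<longlongrightarrow> L) (at (c i))" by blast
    note g_limit_bound[OF L, of i]
    moreover have "c i ^ 4 = - of_real (4 * real (x i) ^ 4)"
    proof -
      \<comment> \<open>This value makes factor \<open>i\<close> of the bound vanish at the corner
        \<open>c i\<close>.\<close>
      have "(1 + \<i>) ^ 4 = -4" by (simp add: eval_nat_numeral algebra_simps)
      moreover have "c i = of_nat (x i) * (1 + \<i>)" by (simp add: c_def pole_g_def algebra_simps)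
      ultimately show ?thesis by (simp add: power_mult_distrib)
    qed
    ultimately have "cmod (c i) \<le> 0" using x_ge_2[of i] by simp
    then show False using pole_series.norm_P_ge_1[OF series_g, of "(1, 1)" i] by (simp add: c_def idx_g_def)
  qed
  then have "range c \<subseteq> {w. poly Q w = 0}" by auto
  then have "finite (range c)" using fin finite_subset by blast
  moreover have "inj c"
  proof (rule injI)
    fix i j assume "c i = c j"
    then have "Re (c i) = Re (c j)" by simp
    then have "x i = x j" by (simp add: c_def pole_g_def)
    then show "i = j" using strict_mono_x by (simp add: strict_mono_eq)
  qed
  ultimately show False using finite_imageD infinite_UNIV_nat by blast
qed

section \<open>Pole counts and growth\<close>

lemma x_le_subset:
  assumes "t < real (x (Suc m))" shows "{j. real (x j) \<le> t} \<subseteq> {..m}"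
proof
  fix j assume "j \<in> {j. real (x j) \<le> t}"
  then have "x j < x (Suc m)" using assms by simp
  then show "j \<in> {..m}" using strict_mono_x by (simp add: strict_mono_less)
qed

text \<open>Block \<open>j\<close> has \<open>4 * x j\<close> poles, and because \<open>x\<close> at
  least doubles, all blocks up to \<open>m\<close> together have at most twice as many as the last
  one.\<close>

lemma nev_n_f_le:
  assumes "t < real (x (Suc m))" shows "nev_n t f \<le> 8 * real (x m)"
proof -
  have "nev_n t f \<le> (\<Sum>j | real (x j) \<le> t. real (4 * x j))" using pole_series.nev_n_S_le[OF series_f, of t] by (simp add: card_idx_f)
  also have "\<dots> \<le> (\<Sum>j\<le>m. real (4 * x j))" by (intro sum_mono2 x_le_subset assms) auto
  also have "\<dots> = real (4 * (\<Sum>j\<le>m. x j))" by (simp add: sum_distrib_left)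
  also have "\<dots> \<le> real (4 * (2 * x m))" by (intro of_nat_mono mult_left_mono sum_x_le) auto
  finally show ?thesis by simp
qed

lemma nev_n_g_le:
  assumes "t < real (x (Suc m))" shows "nev_n t g \<le> 4 * real (Suc m)"
proof -
  have "nev_n t g \<le> 4 * real (card {j. real (x j) \<le> t})"
    using pole_series.nev_n_S_le[OF series_g, of t] by (simp add: card_idx_g)
  also have "card {j. real (x j) \<le> t} \<le> card {..m}" by (intro card_mono x_le_subset assms) auto
  finally show ?thesis by simp
qed

lemma between:
  assumes "real (x 0) \<le> t" obtains m where "real (x m) \<le> t" "t < real (x (Suc m))"
proof -
  have fin: "finite {j. real (x j) \<le> t}" by (rule pole_series.finite_x_le[OF series_f])
  define m where "m = Max {j. real (x j) \<le> t}"
  have "m \<in> {j. real (x j) \<le> t}" unfolding m_def using assms fin by (intro Max_in) auto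
  moreover have "t < real (x (Suc m))"
  proof (rule ccontr)
    assume "\<not> t < real (x (Suc m))"
    then have "Suc m \<le> m" unfolding m_def by (intro Max_ge fin) simp
    then show False by simp
  qed
  ultimately show ?thesis using that by blast
qed

lemma nev_n_f_linear:
  assumes "t > 0" shows "nev_n t f \<le> 8 * t"
proof (cases "real (x 0) \<le> t")
  case True
  then obtain m where "real (x m) \<le> t" "t < real (x (Suc m))" by (rule between)
  then show ?thesis using nev_n_f_le[of t m] by linarith
next
  case False
  have "x 0 \<le> x j" for j using strict_mono_x by (simp add: strict_mono_less_eq)
  then have "{j. real (x j) \<le> t} = {}" using False by (force simp: not_le intro: less_le_trans)
  then have "nev_n t f \<le> 0" using pole_series.nev_n_S_le[OF series_f, of t] by simp
  then show ?thesis using assms by linarith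
qed

lemma exists_slow_growth:
  fixes \<phi> :: "real \<Rightarrow> real"
  assumes \<phi>: "\<And>j r. r \<ge> real (x (Suc j)) - 1 \<Longrightarrow> \<phi> r \<ge> real (x j)"
  shows "\<exists>f :: complex \<Rightarrow> complex.
           f meromorphic_on UNIV \<and> \<not> rational_fun f \<and>
           Limsup at_top (\<lambda>r. ereal (nev_T r f / r)) < \<infinity> \<and>
           Liminf at_top (\<lambda>r. ereal (nev_T r f / (\<phi> r * ln r))) < \<infinity> \<and>
           (let g = (\<lambda>z. f (z + 1) - f z) in
              card (mero_zeros g) = 1 \<and>
              Limsup at_top (\<lambda>r. ereal (nev_T r g / (\<phi> r * ln r))) < \<infinity>)"
proof -
  obtain A where A: "A \<ge> 0" "\<And>r. r \<ge> 1 \<Longrightarrow> nev_m r f \<le> A"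
    using pole_series.nev_m_S_le[OF series_f] by (meson max.cobounded1 max.coboundedI2)
  obtain B where B: "B \<ge> 0" "\<And>r. r \<ge> 1 \<Longrightarrow> nev_m r g \<le> B"
    using pole_series.nev_m_S_le[OF series_g] by (meson max.cobounded1 max.coboundedI2)
  have ln3: "ln r \<ge> 1" if "r \<ge> 3" for r :: real
    using that exp_le by (subst ln_ge_iff) auto
  \<comment> \<open>Here \<open>K\<close> is a pole count up to a constant, namely
    \<open>x J\<close> for \<open>f\<close> and \<open>m\<close> for \<open>g\<close>. The facts
    \<open>K \<le> \<phi> r\<close> and \<open>\<phi> r * ln r \<ge> 1\<close> absorb it and the
    proximity bound \<open>C\<close>.\<close>
  have absorb: "(C + 8 * K * ln r) / (\<phi> r * ln r) \<le> C + 8"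
    if "C \<ge> 0" "r \<ge> 3" "1 \<le> K" "K \<le> \<phi> r" for C K r
  proof -
    have l: "ln r \<ge> 1" using ln3 that by blast
    then have "C * (1 * 1) \<le> C * (\<phi> r * ln r)" using that by (intro mult_left_mono mult_mono) auto
    moreover have "K * ln r \<le> \<phi> r * ln r" using that l by (intro mult_right_mono) auto
    moreover have "\<phi> r * ln r > 0" using that l by (intro mult_pos_pos) auto
    ultimately show ?thesis by (simp add: divide_le_eq algebra_simps)
  qed
  have Tf: "nev_T r f / r \<le> A + 8" if "r \<ge> 1" for r
  proof -
    have "nev_N r f \<le> 8 * r"
      using that by (intro nev_N_le_linear nev_n_f_linear) (auto simp: pole_series.nev_n_S_eq_0[OF series_f])
    moreover have "A * 1 \<le> A * r" using that A by (intro mult_left_mono) auto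
    ultimately have "nev_T r f \<le> (A + 8) * r"
      using A(2)[OF that] by (simp add: nev_T_def algebra_simps)
    then show ?thesis using that by (simp add: divide_le_eq)
  qed
  have Tf': "nev_T r f / (\<phi> r * ln r) \<le> A + 8" if r: "r = real (x (Suc J)) - 1" for r J
  proof -
    have "(2::nat) ^ 4 \<le> x J ^ 4" using x_ge_2[of J] by (intro power_mono) auto
    then have "16 \<le> x (Suc J)" using x_Suc[of J] by simp
    then have r3: "r \<ge> 3" using r by simp
    have "nev_N r f \<le> 8 * real (x J) * ln r"
      using r r3 by (intro nev_N_le_log nev_n_f_le) (auto simp: pole_series.nev_n_S_eq_0[OF series_f])
    then have "nev_T r f \<le> A + 8 * real (x J) * ln r"
      using A(2)[of r] r3 by (simp add: nev_T_def)
    moreover have phi: "real (x J) \<le> \<phi> r" using \<phi> r by simp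
    moreover have "\<phi> r * ln r > 0"
      using phi real_x_pos(2)[of J] ln3[OF r3] by (intro mult_pos_pos) linarith+
    ultimately have "nev_T r f / (\<phi> r * ln r) \<le> (A + 8 * real (x J) * ln r) / (\<phi> r * ln r)"
      by (intro divide_right_mono) auto
    also have "\<dots> \<le> A + 8" using r3 phi A real_x_pos by (intro absorb) auto
    finally show ?thesis .
  qed
  \<comment> \<open>The threshold forces \<open>m \<ge> 1\<close>. Then
    \<open>4 * (m + 1) \<le> 8 * m\<close> bounds the count, and with \<open>m = k + 1\<close> one
    has \<open>\<phi> r \<ge> x k \<ge> k + 1 = m\<close>. The summand 3 ensures
    \<open>ln r \<ge> 1\<close>.\<close>
  have Tg: "nev_T r g / (\<phi> r * ln r) \<le> B + 8" if r: "r \<ge> real (x 1) + 3" for r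
  proof -
    have r3: "r \<ge> 3" using r by simp
    have "x 0 \<le> x 1" using strict_mono_x by (simp add: strict_mono_less_eq)
    then have "real (x 0) \<le> r" using r by simp
    then obtain m where m: "real (x m) \<le> r" "r < real (x (Suc m))" by (rule between)
    have "x 1 < x (Suc m)" using m r by simp
    then have "m \<ge> 1" using strict_mono_x by (simp add: strict_mono_less)
    then obtain k where k: "m = Suc k" by (cases m) auto
    have phi: "real m \<le> \<phi> r" using \<phi>[of k r] m x_ge_index[of k] k by simp
    have "nev_N r g \<le> 8 * real m * ln r"
    proof (rule nev_N_le_log)
      show "nev_n t g \<le> 8 * real m" if "1 \<le> t" "t \<le> r" for t
        using nev_n_g_le[of t m] that m \<open>m \<ge> 1\<close> by simp
    qed (use r3 in \<open>auto simp: pole_series.nev_n_S_eq_0[OF series_g]\<close>)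
    then have "nev_T r g \<le> B + 8 * real m * ln r"
      using B(2)[of r] r3 by (simp add: nev_T_def)
    moreover have "\<phi> r * ln r > 0" using phi \<open>m \<ge> 1\<close> ln3[OF r3] by (intro mult_pos_pos) linarith+
    ultimately have "nev_T r g / (\<phi> r * ln r) \<le> (B + 8 * real m * ln r) / (\<phi> r * ln r)"
      by (intro divide_right_mono) auto
    also have "\<dots> \<le> B + 8" using r3 phi B \<open>m \<ge> 1\<close> by (intro absorb) auto
    finally show ?thesis .
  qed
  have "Limsup at_top (\<lambda>r. ereal (nev_T r f / r)) \<le> ereal (A + 8)"
    using Tf by (intro Limsup_bounded) (auto simp: eventually_at_top_linorder)
  then have 1: "Limsup at_top (\<lambda>r. ereal (nev_T r f / r)) < \<infinity>" by (rule le_less_trans) simp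
  have 2: "Liminf at_top (\<lambda>r. ereal (nev_T r f / (\<phi> r * ln r))) < \<infinity>"
  proof (rule ccontr)
    assume "\<not> ?thesis"
    \<comment> \<open>An infinite lower limit would put the quotient above \<open>A + 8\<close> for
      all large \<open>r\<close>, against \<open>Tf'\<close> at the unbounded radii
      \<open>x (Suc J) - 1\<close>.\<close>
    then have "ereal (A + 8) < Liminf at_top (\<lambda>r. ereal (nev_T r f / (\<phi> r * ln r)))" by simp
    then have "\<forall>\<^sub>F r in at_top. ereal (A + 8) < ereal (nev_T r f / (\<phi> r * ln r))"
      by (rule less_LiminfD)
    then obtain N where N: "\<And>r. r \<ge> N \<Longrightarrow> ereal (A + 8) < ereal (nev_T r f / (\<phi> r * ln r))"
      unfolding eventually_at_top_linorder by blast
    obtain J where "\<forall>j\<ge>J. real (x j) \<ge> N + 1" using pole_series.eventually_x_ge[OF series_f] by blast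
    then have "N \<le> real (x (Suc J)) - 1" by (metis le_SucI le_diff_eq order_refl)
    from N[OF this] Tf'[OF refl, of J] show False by simp
  qed
  have "Limsup at_top (\<lambda>r. ereal (nev_T r g / (\<phi> r * ln r))) \<le> ereal (B + 8)"
    using Tg by (intro Limsup_bounded) (auto simp: eventually_at_top_linorder)
  then have 3: "Limsup at_top (\<lambda>r. ereal (nev_T r g / (\<phi> r * ln r))) < \<infinity>" by (rule le_less_trans) simp
  show ?thesis
    unfolding Let_def
    by (rule exI[of _ f], unfold difference_S mero_zeros_g)
      (intro conjI pole_series.meromorphic_S[OF series_f] not_rational_f 1 2 3, simp)
qed

end

section \<open>Choice of the sparse sequence\<close>

lemma exists_sparse_sequence:
  fixes \<phi> :: "real \<Rightarrow> real"
  assumes "filterlim \<phi> at_top at_top"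
  obtains x :: "nat \<Rightarrow> nat" where "x 0 = 2" "\<And>j. x j ^ 4 \<le> x (Suc j)"
    "\<And>j r. r \<ge> real (x (Suc j)) - 1 \<Longrightarrow> \<phi> r \<ge> real (x j)"
proof -
  have "\<exists>m. n ^ 4 \<le> m \<and> (\<forall>r\<ge>real m - 1. \<phi> r \<ge> real n)" for n :: nat
  proof -
    obtain N where N: "\<And>r. r \<ge> N \<Longrightarrow> \<phi> r \<ge> real n"
      using assms unfolding filterlim_at_top eventually_at_top_linorder by blast
    \<comment> \<open>The first entry of the maximum gives sparseness. The second makes
      \<open>\<phi>\<close> large already one unit before the next block, where the lower limit is
      tested.\<close>
    have "real (max (n ^ 4) (nat \<lceil>N + 1\<rceil>)) \<ge> N + 1" by linarith
    then show ?thesis using N by (intro exI[of _ "max (n ^ 4) (nat \<lceil>N + 1\<rceil>)"]) auto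
  qed
  then obtain next' where n: "\<And>n. n ^ 4 \<le> next' n" "\<And>n r. r \<ge> real (next' n) - 1 \<Longrightarrow> \<phi> r \<ge> real n"
    by metis
  show ?thesis by (rule that[of "rec_nat 2 (\<lambda>_. next')"]) (auto intro: n)
qed

theorem theorem1p5:
  fixes \<phi> :: "real \<Rightarrow> real"
  assumes pos: "\<And>r. r \<ge> 1 \<Longrightarrow> \<phi> r > 0"
    and mono: "mono_on {1..} \<phi>"
    and lim: "filterlim \<phi> at_top at_top"
  shows "\<exists>f :: complex \<Rightarrow> complex.
           f meromorphic_on UNIV \<and> \<not> rational_fun f \<and>
           Limsup at_top (\<lambda>r. ereal (nev_T r f / r)) < \<infinity> \<and>
           Liminf at_top (\<lambda>r. ereal (nev_T r f / (\<phi> r * ln r))) < \<infinity> \<and>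
           (let g = (\<lambda>z. f (z + 1) - f z) in
              card (mero_zeros g) = 1 \<and>
              Limsup at_top (\<lambda>r. ereal (nev_T r g / (\<phi> r * ln r))) < \<infinity>)"
proof -
  obtain x :: "nat \<Rightarrow> nat" where "x 0 = 2" "\<And>j. x j ^ 4 \<le> x (Suc j)"
    and \<phi>: "\<And>j r. r \<ge> real (x (Suc j)) - 1 \<Longrightarrow> \<phi> r \<ge> real (x j)"
    using exists_sparse_sequence[OF lim] by blast
  then have "sparse_strings x" by unfold_locales auto
  then show ?thesis using \<phi> by (rule sparse_strings.exists_slow_growth)
qed

end
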